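(* Let $U\subset\mathbb{R}^n$ be a bounded open set and let $\omega\subset U$ be a set belonging to $\mathcal{A}_n(s,a)$ with $n-1<s\le n$. Assume also that $$\lambda:=\frac{\{\mathcal{H}_s(\omega)\}^{n/s}}{\mathcal{H}_n(U)}>0.$$ Let $0<q,r\le\infty$. Then there is a constant $C>1$ such that for every polynomial $p\in\mathbb{R}[x_1,\dots,x_n]$ of degree $k$ $$\left(\frac{1}{\mathcal{H}_n(U)}\int_U|p|^r\,d\mathcal{H}_n\right)^{1/r}\le C\left(\frac{1}{\mathcal{H}_s(\omega)}\int_\omega|p|^q\,d\mathcal{H}_s\right)^{1/q}.$$ Here $C$ depends only on $U,n,q,r,s,k,a$ and $\lambda$ (and not otherwise on $\omega$), and is increasing in $1/\lambda$. In particular, for $q=r=\infty$ one obtains $\sup_U|p|\le C\sup_\omega|p|$ for all such $p$.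
   Context: $\mathcal{H}_s$ denotes the $s$-dimensional Hausdorff measure on $\mathbb{R}^n$. For $q=\infty$ (or $r=\infty$) the normalized integral means are replaced by the corresponding (essential) suprema. For $K\subset\mathbb{R}^n$ and $x\in K$, $B_r(x;K)$ denotes the intersection with $K$ of the open Euclidean ball of radius $r$ centered at $x$. $\mathcal{A}_n(s,a)$ (with $a>0$) is the class of sets $K\subset\mathbb{R}^n$ such that $\mathcal{H}_s(B_r(x;K))\le a r^s$ for every $x\in K$ and every $0<r\le\operatorname{diam}(K)$. The set $\omega$ is understood to be $\mathcal{H}_s$-measurable, so that the integral over $\omega$ makes sense. *)

theory Defs
  imports "HOL-Probability.Essential_Supremum" "HOL-Library.Poly_Mapping"
begin


subsection \<open>Hausdorff measure\<close>

text \<open>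
  Covers are countable families of sets of diameter at most \<open>\<delta>\<close>.  Boundedness is
  required separately because \<^const>\<open>diameter\<close> is a meaningless real number on unbounded
  sets.  The weight of a set of diameter \<open>d\<close> is the volume of the \<open>s\<close>-dimensional
  ball of diameter \<open>d\<close>; with this normalization the \<open>n\<close>-dimensional measure on
  \<open>n\<close>-dimensional Euclidean space is Lebesgue measure.  The definitions are meant for \<open>s > 0\<close>:
  for \<open>s = 0\<close> the convention \<open>0 powr 0 = 0\<close> does not give counting measure.
\<close>

definition hausdorff_pre :: "real \<Rightarrow> real \<Rightarrow> 'a::metric_space set \<Rightarrow> ennreal" where
  "hausdorff_pre s \<delta> E =
    (INF A\<in>{A :: nat \<Rightarrow> 'a set. E \<subseteq> (\<Union>i. A i) \<and> (\<forall>i. bounded (A i) \<and> diameter (A i) \<le> \<delta>)}.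
      suminf (\<lambda>i. ennreal (unit_ball_vol s * (diameter (A i) / 2) powr s)))"

definition hausdorff_outer :: "real \<Rightarrow> 'a::metric_space set \<Rightarrow> ennreal" where
  "hausdorff_outer s E = (SUP \<delta>\<in>{0<..}. hausdorff_pre s \<delta> E)"

text \<open>The measurable sets are those satisfying Caratheodory's criterion.\<close>

definition hausdorff_measure :: "real \<Rightarrow> 'a::metric_space measure" where
  "hausdorff_measure s =
    measure_of UNIV (lambda_system UNIV UNIV (hausdorff_outer s)) (hausdorff_outer s)"

lemma hausdorff_pre_mono: "E \<subseteq> F \<Longrightarrow> hausdorff_pre s \<delta> E \<le> hausdorff_pre s \<delta> F"
  unfolding hausdorff_pre_def by (rule INF_superset_mono) auto

lemma hausdorff_pre_subadditive:
  fixes A :: "nat \<Rightarrow> 'a::metric_space set"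
  shows "hausdorff_pre s \<delta> (\<Union>i. A i) \<le> suminf (\<lambda>i. hausdorff_pre s \<delta> (A i))"
proof -
  let ?w = "\<lambda>B :: 'a set. ennreal (unit_ball_vol s * (diameter B / 2) powr s)"
  show ?thesis
  proof (rule ennreal_le_epsilon)
    fix e :: real
    assume e: "0 < e" and fin: "suminf (\<lambda>i. hausdorff_pre s \<delta> (A i)) < top"
    have "\<exists>B :: nat \<Rightarrow> 'a set. A n \<subseteq> (\<Union>i. B i)
          \<and> (\<forall>i. bounded (B i) \<and> diameter (B i) \<le> \<delta>)
          \<and> suminf (\<lambda>i. ?w (B i)) \<le> hausdorff_pre s \<delta> (A n) + ennreal (e * (1/2) ^ Suc n)" for n
    proof -
      have "hausdorff_pre s \<delta> (A n) < top"
        using fin ennreal_suminf_lessD by blast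
      then have "hausdorff_pre s \<delta> (A n) < hausdorff_pre s \<delta> (A n) + ennreal (e * (1/2) ^ Suc n)"
        using e by (simp add: ennreal_add_left_cancel_less[of _ 0, simplified])
      then show ?thesis
        by (subst (asm) hausdorff_pre_def) (auto simp: INF_less_iff intro: less_imp_le)
    qed
    then obtain B :: "nat \<Rightarrow> nat \<Rightarrow> 'a set"
      where B: "\<And>n. A n \<subseteq> (\<Union>i. B n i)" "\<And>n i. bounded (B n i)" "\<And>n i. diameter (B n i) \<le> \<delta>"
        and le: "\<And>n. suminf (\<lambda>i. ?w (B n i)) \<le> hausdorff_pre s \<delta> (A n) + ennreal (e * (1/2) ^ Suc n)"
      by metis
    define C where "C = case_prod B \<circ> prod_decode"
    have "(\<Union>i. A i) \<subseteq> (\<Union>i. C i)"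
    proof
      fix x assume "x \<in> (\<Union>i. A i)"
      then obtain n i where "x \<in> B n i" using B(1) by blast
      then have "x \<in> C (prod_encode (n, i))" by (simp add: C_def)
      then show "x \<in> (\<Union>i. C i)" by blast
    qed
    moreover have "bounded (C i) \<and> diameter (C i) \<le> \<delta>" for i
      using B(2,3) by (simp add: C_def split: prod.split)
    ultimately have "hausdorff_pre s \<delta> (\<Union>i. A i) \<le> suminf (\<lambda>i. ?w (C i))"
      unfolding hausdorff_pre_def by (intro INF_lower) simp
    also have "\<dots> = suminf (\<lambda>i. ?w (case_prod B (prod_decode i)))"
      by (simp add: C_def)
    also have "\<dots> = suminf (\<lambda>n. suminf (\<lambda>i. ?w (B n i)))"
      by (rule suminf_ennreal_2dimen) simp
    also have "\<dots> \<le> suminf (\<lambda>n. hausdorff_pre s \<delta> (A n) + ennreal (e * (1/2) ^ Suc n))"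
      by (intro suminf_le le) auto
    also have "\<dots> = suminf (\<lambda>n. hausdorff_pre s \<delta> (A n)) + suminf (\<lambda>n. ennreal (e * (1/2) ^ Suc n))"
      by (intro suminf_add[symmetric]) auto
    also have "suminf (\<lambda>n. ennreal (e * (1/2) ^ Suc n)) = ennreal e"
      using e by (intro suminf_ennreal_eq) (use sums_mult[OF power_half_series, of e] in auto)
    finally show "hausdorff_pre s \<delta> (\<Union>i. A i) \<le> suminf (\<lambda>i. hausdorff_pre s \<delta> (A i)) + ennreal e" .
  qed
qed

lemma outer_measure_space_hausdorff_outer:
  "outer_measure_space UNIV (hausdorff_outer s :: 'a::metric_space set \<Rightarrow> ennreal)"
proof -
  have "hausdorff_pre s \<delta> ({} :: 'a set) = 0" if "0 < \<delta>" for \<delta>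
  proof -
    have "hausdorff_pre s \<delta> ({} :: 'a set)
        \<le> suminf (\<lambda>i::nat. ennreal (unit_ball_vol s * (diameter ({} :: 'a set) / 2) powr s))"
      unfolding hausdorff_pre_def using that by (intro INF_lower) simp
    then show ?thesis by simp
  qed
  then have "hausdorff_outer s ({} :: 'a set) = 0"
    by (simp add: hausdorff_outer_def SUP_eq_const[of _ _ 0])
  moreover have "hausdorff_outer s E \<le> hausdorff_outer s F" if "E \<subseteq> F" for E F :: "'a set"
    unfolding hausdorff_outer_def by (intro SUP_mono) (use hausdorff_pre_mono[OF that] in blast)
  moreover have "hausdorff_outer s (\<Union>i. A i) \<le> suminf (\<lambda>i. hausdorff_outer s (A i))"
    for A :: "nat \<Rightarrow> 'a set"
    unfolding hausdorff_outer_def[of s "\<Union>i. A i"]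
  proof (rule SUP_least)
    fix \<delta> :: real assume "\<delta> \<in> {0<..}"
    then have "hausdorff_pre s \<delta> (A i) \<le> hausdorff_outer s (A i)" for i
      unfolding hausdorff_outer_def by (rule SUP_upper)
    then have "suminf (\<lambda>i. hausdorff_pre s \<delta> (A i)) \<le> suminf (\<lambda>i. hausdorff_outer s (A i))"
      by (intro suminf_le) auto
    then show "hausdorff_pre s \<delta> (\<Union>i. A i) \<le> suminf (\<lambda>i. hausdorff_outer s (A i))"
      using hausdorff_pre_subadditive order_trans by blast
  qed
  ultimately show ?thesis
    by (simp add: outer_measure_space_def positive_def increasing_def countably_subadditive_def)
qed

lemma measure_space_hausdorff:
  "measure_space UNIV (lambda_system UNIV UNIV (hausdorff_outer s)) (hausdorff_outer s)"
  by (rule sigma_algebra.caratheodory_lemma[OF _ outer_measure_space_hausdorff_outer])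
    (use sigma_algebra_Pow[of UNIV] in simp)

lemma space_hausdorff_measure [simp]: "space (hausdorff_measure s) = UNIV"
  by (simp add: hausdorff_measure_def space_measure_of_conv)

lemma sets_hausdorff_measure:
  "sets (hausdorff_measure s) = lambda_system UNIV UNIV (hausdorff_outer s)"
  unfolding hausdorff_measure_def
  using sigma_algebra.sets_measure_of_eq measure_space_hausdorff measure_space_def by blast

lemma emeasure_hausdorff_measure:
  assumes "E \<in> sets (hausdorff_measure s)"
  shows "emeasure (hausdorff_measure s) E = hausdorff_outer s E"
  using assms measure_space_hausdorff[of s]
  unfolding sets_hausdorff_measure
  by (auto simp: hausdorff_measure_def measure_space_def
      intro!: emeasure_measure_of_sigma)


subsection \<open>The class of upper \<open>s\<close>-regular sets\<close>

text \<open>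
  The outer measure makes the condition meaningful for arbitrary sets.  An unbounded set has
  infinite diameter, so then every positive radius is admitted.
\<close>

definition upper_regular :: "real \<Rightarrow> real \<Rightarrow> 'a::metric_space set set" where
  "upper_regular s a =
    {K. \<forall>x\<in>K. \<forall>\<rho>>0. (bounded K \<longrightarrow> \<rho> \<le> diameter K) \<longrightarrow>
          hausdorff_outer s (ball x \<rho> \<inter> K) \<le> ennreal (a * \<rho> powr s)}"

definition density_ratio :: "real \<Rightarrow> (real ^ 'n) set \<Rightarrow> (real ^ 'n) set \<Rightarrow> real" where
  "density_ratio s U \<omega> =
    measure (hausdorff_measure s) \<omega> powr (real CARD('n) / s)
      / measure (hausdorff_measure (real CARD('n))) U"


subsection \<open>Polynomials in several variables\<close>

text \<open>
  A polynomial in the variables indexed by \<open>'n\<close> is a finitely supported map from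
  exponents to coefficients.  The zero polynomial gets degree \<open>0\<close>.
\<close>

type_synonym 'n rpoly = "('n \<Rightarrow>\<^sub>0 nat) \<Rightarrow>\<^sub>0 real"

definition eval_rpoly :: "'n::finite rpoly \<Rightarrow> real ^ 'n \<Rightarrow> real" where
  "eval_rpoly p x =
    (\<Sum>m\<in>Poly_Mapping.keys p. Poly_Mapping.lookup p m * (\<Prod>i\<in>UNIV. x $ i ^ Poly_Mapping.lookup m i))"

definition rpoly_degree :: "'n::finite rpoly \<Rightarrow> nat" where
  "rpoly_degree p =
    Max (insert 0 ((\<lambda>m. \<Sum>i\<in>UNIV. Poly_Mapping.lookup m i) ` Poly_Mapping.keys p))"


subsection \<open>Normalized integral means\<close>

definition integral_mean :: "'a measure \<Rightarrow> 'a set \<Rightarrow> ennreal \<Rightarrow> ('a \<Rightarrow> real) \<Rightarrow> real" where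
  "integral_mean M A q f =
    (if q = \<infinity> then enn2real (esssup (restrict_space M A) (\<lambda>x. ennreal \<bar>f x\<bar>))
     else ((LINT x:A|M. \<bar>f x\<bar> powr enn2real q) / measure M A) powr (1 / enn2real q))"

end

theory Submission
  imports Defs "HOL-Computational_Algebra.Fundamental_Theorem_Algebra"
begin

text \<open>
  The point is that, with \<open>C\<close> depending only on \<open>h\<close>, \<open>n\<close>, \<open>k\<close> and \<open>U\<close>, the set where
  \<open>C * \<bar>p\<bar> < sup \<bar>p\<bar>\<close> is covered by \<open>O(h^(1 - n))\<close> balls of radius \<open>O(h)\<close>.  The centres are the real
  parts of the complex zeros of \<open>p\<close> on the axis-parallel lines through the lattice \<open>h \<int>\<^sup>n\<close>: there are
  \<open>O(h^(1 - n))\<close> such lines, each with at most \<open>k\<close> zeros.  Around a point far from all these centres,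
  \<open>p\<close> is almost constant on a box of \<open>(k + 1)^n\<close> lattice points, hence, by interpolation, comparable
  there to its value at that point, and again by interpolation its supremum over \<open>U\<close> is controlled.
  Upper regularity bounds the \<open>s\<close>-dimensional measure of the part of \<open>\<omega>\<close> in the exceptional
  balls by \<open>O(h^(s - n + 1))\<close>, which is less than half the measure of \<open>\<omega>\<close> for small \<open>h\<close> since
  \<open>s > n - 1\<close>; on the rest of \<open>\<omega>\<close> the polynomial is at least a fixed fraction of its supremum over \<open>U\<close>.
\<close>

subsection \<open>Polynomials along axis-parallel lines\<close>

text \<open>Induction on \<open>k\<close> replaces explicit Lagrange polynomials: dividing out the
  last node \<open>a = k + 1\<close> lowers the degree, and the quotient stays controlled at the
  other nodes because their distance from \<open>a\<close> is at least 1.\<close>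

lemma poly_bound_from_nodes:
  assumes "0 \<le> T"
  shows "\<exists>L\<ge>1. \<forall>f :: real poly. degree f \<le> k \<longrightarrow>
    (\<forall>e t. (\<forall>j\<le>k. \<bar>poly f (real j)\<bar> \<le> e) \<longrightarrow> \<bar>t\<bar> \<le> T \<longrightarrow> \<bar>poly f t\<bar> \<le> L * e)"
proof (induction k)
  case 0
  show ?case
    by (rule exI[of _ 1]) (auto elim!: degree_eq_zeroE)
next
  case (Suc k)
  then obtain L where L: "L \<ge> 1" "\<And>f :: real poly. \<And>e t. degree f \<le> k \<Longrightarrow>
    (\<And>j. j \<le> k \<Longrightarrow> \<bar>poly f (real j)\<bar> \<le> e) \<Longrightarrow> \<bar>t\<bar> \<le> T \<Longrightarrow> \<bar>poly f t\<bar> \<le> L * e"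
    by metis
  define L' where "L' = 1 + (T + real (Suc k)) * (2 * L)"
  have "\<bar>poly f t\<bar> \<le> L' * e"
    if f: "degree f \<le> Suc k" and e: "\<forall>j\<le>Suc k. \<bar>poly f (real j)\<bar> \<le> e" and t: "\<bar>t\<bar> \<le> T"
    for f :: "real poly" and e t
  proof -
    define a where "a = real (Suc k)"
    define g where "g = synthetic_div f a"
    have fg: "poly f x = (x - a) * poly g x + poly f a" for x
      using arg_cong[OF synthetic_div_correct'[of a f], of "\<lambda>p. poly p x"]
      by (simp add: g_def algebra_simps)
    have fa: "\<bar>poly f a\<bar> \<le> e"
      using e[rule_format, of "Suc k"] by (simp add: a_def)
    have "\<bar>poly g (real j)\<bar> \<le> 2 * e" if "j \<le> k" for j
    proof -
      have "\<bar>real j - a\<bar> * \<bar>poly g (real j)\<bar> = \<bar>poly f (real j) - poly f a\<bar>"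
        using fg[of "real j"] by (simp flip: abs_mult)
      also have "\<dots> \<le> 2 * e"
        using fa e[rule_format, of j] that by linarith
      finally have *: "\<bar>real j - a\<bar> * \<bar>poly g (real j)\<bar> \<le> 2 * e" .
      have "1 * \<bar>poly g (real j)\<bar> \<le> \<bar>real j - a\<bar> * \<bar>poly g (real j)\<bar>"
        using that by (intro mult_right_mono) (auto simp: a_def)
      with * show ?thesis by simp
    qed
    then have "\<bar>poly g t\<bar> \<le> L * (2 * e)"
      using f t by (intro L) (auto simp: g_def degree_synthetic_div)
    moreover have "\<bar>t - a\<bar> \<le> T + a"
      using t by (simp add: a_def)
    ultimately have "\<bar>(t - a) * poly g t\<bar> \<le> (T + a) * (L * (2 * e))"
      unfolding abs_mult by (intro mult_mono) (use assms a_def in auto)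
    then have "\<bar>poly f t\<bar> \<le> (T + a) * (L * (2 * e)) + e"
      using fg[of t] fa by linarith
    then show ?thesis
      by (simp add: L'_def a_def algebra_simps)
  qed
  moreover have "L' \<ge> 1"
    using L(1) assms by (simp add: L'_def)
  ultimately show ?case by blast
qed

text \<open>Rescaling of the previous lemma. The point is that \<open>L\<close> depends on
  \<open>T\<close> and \<open>k\<close>, but on neither \<open>y\<close> nor
  \<open>h\<close>.\<close>

lemma poly_bound_from_spaced_nodes:
  assumes "0 \<le> T"
  shows "\<exists>L\<ge>1. \<forall>f :: real poly. degree f \<le> k \<longrightarrow>
    (\<forall>e t y h. 0 < h \<longrightarrow> (\<forall>j\<le>k. \<bar>poly f (y + h * real j)\<bar> \<le> e) \<longrightarrow> \<bar>t - y\<bar> \<le> T * h \<longrightarrow>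
      \<bar>poly f t\<bar> \<le> L * e)"
proof -
  obtain L where L: "L \<ge> 1" "\<And>f :: real poly. \<And>e t. degree f \<le> k \<Longrightarrow>
    (\<And>j. j \<le> k \<Longrightarrow> \<bar>poly f (real j)\<bar> \<le> e) \<Longrightarrow> \<bar>t\<bar> \<le> T \<Longrightarrow> \<bar>poly f t\<bar> \<le> L * e"
    using poly_bound_from_nodes[OF assms, of k] by metis
  have "\<bar>poly f t\<bar> \<le> L * e"
    if "degree f \<le> k" "0 < h" "\<forall>j\<le>k. \<bar>poly f (y + h * real j)\<bar> \<le> e" "\<bar>t - y\<bar> \<le> T * h"
    for f :: "real poly" and e t y h
  proof -
    have "\<bar>poly (f \<circ>\<^sub>p [:y, h:]) ((t - y) / h)\<bar> \<le> L * e"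
      using that by (intro L) (auto simp: poly_pcompose degree_pcompose mult.commute divide_simps)
    then show ?thesis using \<open>0 < h\<close> by (simp add: poly_pcompose)
  qed
  with L(1) show ?thesis by blast
qed

section \<open>Relative oscillation away from the zeros\<close>

text \<open>\<open>Z\<close> collects zeros of \<open>f\<close>. For each linear factor,
  \<open>y' - r\<close> is \<open>y - r\<close> times some \<open>1 + u\<close> with
  \<open>cmod u\<close> at most \<open>cmod (y' - y) / D\<close>, so at most \<open>k\<close>
  factors change \<open>f\<close> by the stated relative amount. Only \<open>y\<close> has to be far
  from \<open>Z\<close>; \<open>y'\<close> is arbitrary.\<close>

lemma complex_poly_oscillation:
  fixes f :: "complex poly"
  assumes "degree f \<le> k"
  shows "\<exists>Z. finite Z \<and> card Z \<le> k \<and> (\<forall>D>0. \<forall>y y'. (\<forall>z\<in>Z. D \<le> cmod (y - z)) \<longrightarrow>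
    cmod (poly f y' - poly f y) \<le> ((1 + cmod (y' - y) / D) ^ k - 1) * cmod (poly f y))"
  using assms
proof (induction k arbitrary: f)
  case 0
  then show ?case
    by (intro exI[of _ "{}"]) (auto elim!: degree_eq_zeroE)
next
  case (Suc k)
  show ?case
  proof (cases "degree f = 0")
    case True
    then show ?thesis
      by (intro exI[of _ "{}"]) (auto elim!: degree_eq_zeroE intro!: mult_nonneg_nonneg one_le_power
            simp del: power_Suc)
  next
    case False
    then obtain r where r: "poly f r = 0"
      using fundamental_theorem_of_algebra constant_degree by metis
    define g where "g = synthetic_div f r"
    have fg: "poly f x = (x - r) * poly g x" for x
      using arg_cong[OF synthetic_div_correct'[of r f], of "\<lambda>p. poly p x"] r
      by (simp add: g_def algebra_simps)
    have "degree g \<le> k"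
      using Suc.prems by (simp add: g_def degree_synthetic_div)
    then obtain Z where Z: "finite Z" "card Z \<le> k"
      "\<And>D y y'. D > 0 \<Longrightarrow> (\<forall>z\<in>Z. D \<le> cmod (y - z)) \<Longrightarrow>
        cmod (poly g y' - poly g y) \<le> ((1 + cmod (y' - y) / D) ^ k - 1) * cmod (poly g y)"
      using Suc.IH by metis
    have "cmod (poly f y' - poly f y) \<le> ((1 + cmod (y' - y) / D) ^ Suc k - 1) * cmod (poly f y)"
      if D: "D > 0" and far: "\<forall>z\<in>insert r Z. D \<le> cmod (y - z)" for D y y'
    proof -
      define B where "B = 1 + cmod (y' - y) / D"
      define u where "u = (y' - y) / (y - r)"
      have yr: "D \<le> cmod (y - r)" using far by simp
      with D have [simp]: "y \<noteq> r" by auto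
      have u: "cmod u \<le> B - 1"
        using D yr by (simp add: u_def B_def norm_divide frac_le)
      have y'r: "y' - r = (y - r) * (1 + u)"
        by (simp add: u_def distrib_left)
      have g: "cmod (poly g y' - poly g y) \<le> (B ^ k - 1) * cmod (poly g y)"
        unfolding B_def using D far by (intro Z) auto
      have "cmod (poly g y') \<le> cmod (poly g y' - poly g y) + cmod (poly g y)"
        by (metis diff_add_cancel norm_triangle_ineq)
      with g have g': "cmod (poly g y') \<le> B ^ k * cmod (poly g y)"
        by (simp add: algebra_simps)
      \<comment> \<open>Telescoping: \<open>u * poly g y'\<close> accounts for the change of the
        linear factor, \<open>poly g y' - poly g y\<close> for that of the quotient.\<close>
      have "poly f y' - poly f y = (y - r) * (u * poly g y' + (poly g y' - poly g y))"
        by (simp add: fg y'r algebra_simps)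
      then have "cmod (poly f y' - poly f y)
          \<le> cmod (y - r) * (cmod u * cmod (poly g y') + cmod (poly g y' - poly g y))"
        by (metis norm_mult norm_triangle_ineq mult_left_mono norm_ge_zero)
      also have "\<dots> \<le> cmod (y - r) * ((B - 1) * (B ^ k * cmod (poly g y)) + (B ^ k - 1) * cmod (poly g y))"
        using u g g' by (intro mult_left_mono add_mono mult_mono) (auto simp: B_def D less_imp_le)
      also have "\<dots> = (B ^ Suc k - 1) * cmod (poly f y)"
        unfolding fg norm_mult by (simp add: left_diff_distrib right_diff_distrib mult_ac)
      finally show ?thesis by (simp add: B_def)
    qed
    moreover have "card (insert r Z) \<le> Suc k"
      using Z by (simp add: card_insert_if)
    ultimately show ?thesis
      using Z(1) by (intro exI[of _ "insert r Z"]) blast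
  qed
qed

text \<open>A full set of linear factors exists only over the complex numbers. The real parts of the
  zeros serve as centres, since for real \<open>y\<close> the distance to \<open>Re z\<close> is at
  most the distance to \<open>z\<close>.\<close>

lemma real_poly_oscillation:
  fixes f :: "real poly"
  assumes "degree f \<le> k"
  shows "\<exists>Z. finite Z \<and> card Z \<le> k \<and> (\<forall>D>0. \<forall>y y'. (\<forall>z\<in>Z. D \<le> \<bar>y - z\<bar>) \<longrightarrow>
    \<bar>poly f y' - poly f y\<bar> \<le> ((1 + \<bar>y' - y\<bar> / D) ^ k - 1) * \<bar>poly f y\<bar>)"
proof -
  let ?F = "map_poly complex_of_real f"
  have "degree ?F \<le> k"
    using assms by (simp add: degree_map_poly)
  then obtain Z where Z: "finite Z" "card Z \<le> k"
    "\<And>D y y'. D > 0 \<Longrightarrow> (\<forall>z\<in>Z. D \<le> cmod (y - z)) \<Longrightarrow>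
      cmod (poly ?F y' - poly ?F y) \<le> ((1 + cmod (y' - y) / D) ^ k - 1) * cmod (poly ?F y)"
    using complex_poly_oscillation by metis
  have pF: "poly ?F (of_real x) = of_real (poly f x)" for x
    by (induction f) (auto simp: map_poly_pCons)
  have "\<bar>poly f y' - poly f y\<bar> \<le> ((1 + \<bar>y' - y\<bar> / D) ^ k - 1) * \<bar>poly f y\<bar>"
    if "D > 0" "\<forall>z\<in>Re ` Z. D \<le> \<bar>y - z\<bar>" for D y y'
  proof -
    have "D \<le> cmod (of_real y - z)" if "z \<in> Z" for z
      using \<open>\<forall>z\<in>Re ` Z. D \<le> \<bar>y - z\<bar>\<close> that abs_Re_le_cmod[of "of_real y - z"] by fastforce
    from Z(3)[OF \<open>D > 0\<close>, of "of_real y" "of_real y'"] this show ?thesis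
      by (simp add: pF flip: of_real_diff)
  qed
  moreover have "card (Re ` Z) \<le> k"
    using card_image_le[OF Z(1), of Re] Z(2) by simp
  ultimately show ?thesis
    using Z(1) by (intro exI[of _ "Re ` Z"]) blast
qed

section \<open>Several variables, one coordinate at a time\<close>

definition axis_upd :: "real ^ 'n \<Rightarrow> 'n \<Rightarrow> real \<Rightarrow> real ^ 'n" where
  "axis_upd x i t = (\<chi> l. if l = i then t else x $ l)"

lemma axis_upd_nth [simp]: "axis_upd x i t $ l = (if l = i then t else x $ l)"
  by (simp add: axis_upd_def)

lemma axis_upd_same [simp]: "axis_upd x i (x $ i) = x"
  by (simp add: vec_eq_iff)

lemma axis_upd_upd [simp]: "axis_upd (axis_upd x i t) i t' = axis_upd x i t'"
  by (simp add: vec_eq_iff)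

text \<open>The one property of \<open>eval_rpoly p\<close> that the covering argument uses; it lets
  the one-variable lemmas act on each coordinate in turn.\<close>

definition coord_poly :: "nat \<Rightarrow> (real ^ 'n \<Rightarrow> real) \<Rightarrow> bool" where
  "coord_poly k g \<longleftrightarrow> (\<forall>x i. \<exists>f. degree f \<le> k \<and> (\<forall>t. g (axis_upd x i t) = poly f t))"

lemma coord_poly_diff_const:
  assumes "coord_poly k g"
  shows "coord_poly k (\<lambda>x. g x - b)"
  unfolding coord_poly_def
proof (intro allI)
  fix x i
  obtain f where "degree f \<le> k" "\<And>t. g (axis_upd x i t) = poly f t"
    using assms unfolding coord_poly_def by metis
  then show "\<exists>f. degree f \<le> k \<and> (\<forall>t. g (axis_upd x i t) - b = poly f t)"
    by (intro exI[of _ "f - [:b:]"]) (auto intro: degree_diff_le)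
qed

text \<open>The interpolation nodes, a product grid whose lowest corner is \<open>y\<close> for
  positive \<open>h\<close>.\<close>

definition lattice_box :: "nat \<Rightarrow> real \<Rightarrow> real ^ 'n \<Rightarrow> (real ^ 'n) set" where
  "lattice_box k h y = {x. \<forall>i. \<exists>j\<le>k. x $ i = y $ i + h * real j}"

text \<open>Used twice below: with \<open>T = 1\<close> to compare a point with a grid next to it,
  and with \<open>T\<close> of order \<open>1 / h\<close> to reach the whole region from one small
  grid.\<close>

lemma coord_poly_bound_from_box:
  assumes "0 \<le> T"
  shows "\<exists>L\<ge>1. \<forall>g :: real ^ 'n::finite \<Rightarrow> real. coord_poly k g \<longrightarrow> (\<forall>h>0. \<forall>e y x.
    (\<forall>z\<in>lattice_box k h y. \<bar>g z\<bar> \<le> e) \<longrightarrow> (\<forall>i. \<bar>x $ i - y $ i\<bar> \<le> T * h) \<longrightarrow> \<bar>g x\<bar> \<le> L * e)"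
proof -
  obtain L where L: "L \<ge> 1" "\<And>f :: real poly. \<And>e t y h. degree f \<le> k \<Longrightarrow> 0 < h \<Longrightarrow>
    (\<And>j. j \<le> k \<Longrightarrow> \<bar>poly f (y + h * real j)\<bar> \<le> e) \<Longrightarrow> \<bar>t - y\<bar> \<le> T * h \<Longrightarrow> \<bar>poly f t\<bar> \<le> L * e"
    using poly_bound_from_spaced_nodes[OF assms, of k] by metis
  have "\<bar>g x\<bar> \<le> L ^ CARD('n) * e"
    if g: "coord_poly k g" and h: "0 < h" and e: "\<forall>z\<in>lattice_box k h y. \<bar>g z\<bar> \<le> e"
      and x: "\<forall>i. \<bar>x $ i - y $ i\<bar> \<le> T * h" for g :: "real ^ 'n \<Rightarrow> real" and h e y x
  proof -
    \<comment> \<open>The coordinates in \<open>I\<close> have been released from the grid.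
      Releasing one more is interpolation in one variable and costs a factor
      \<open>L\<close>.\<close>
    have "\<forall>x. (\<forall>i. (i \<in> I \<longrightarrow> \<bar>x $ i - y $ i\<bar> \<le> T * h) \<and> (i \<notin> I \<longrightarrow> (\<exists>j\<le>k. x $ i = y $ i + h * real j)))
        \<longrightarrow> \<bar>g x\<bar> \<le> L ^ card I * e" if "finite I" for I
      using that
    proof (induction I rule: finite_induct)
      case empty
      then show ?case using e by (auto simp: lattice_box_def)
    next
      case (insert i I)
      show ?case
      proof (intro allI impI)
        fix x
        assume x: "\<forall>l. (l \<in> insert i I \<longrightarrow> \<bar>x $ l - y $ l\<bar> \<le> T * h) \<and>
          (l \<notin> insert i I \<longrightarrow> (\<exists>j\<le>k. x $ l = y $ l + h * real j))"
        obtain f where f: "degree f \<le> k" "\<And>t. g (axis_upd x i t) = poly f t"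
          using g unfolding coord_poly_def by metis
        show "\<bar>g x\<bar> \<le> L ^ card (insert i I) * e"
        proof -
          have "\<bar>poly f (y $ i + h * real j)\<bar> \<le> L ^ card I * e" if "j \<le> k" for j
            unfolding f(2)[symmetric] using x insert.hyps that
            by (intro insert.IH[rule_format]) auto
          moreover have "\<bar>x $ i - y $ i\<bar> \<le> T * h" using x by simp
          ultimately have "\<bar>poly f (x $ i)\<bar> \<le> L * (L ^ card I * e)"
            using f(1) h by (intro L(2)) auto
          then show ?thesis
            using insert.hyps by (simp flip: f(2))
        qed
      qed
    qed
    from this[of UNIV] x show ?thesis by simp
  qed
  moreover have "L ^ CARD('n) \<ge> 1" using L(1) by simp
  ultimately show ?thesis by blast
qed

text \<open>The corner \<open>y\<close> is reached from \<open>z\<close> by resetting one coordinate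
  at a time; relative errors compound multiplicatively, each move contributing a factor
  \<open>A\<close>. The induction is over the set of coordinates in which \<open>z\<close> may
  differ from \<open>y\<close>.\<close>

lemma lattice_box_oscillation:
  fixes g :: "real ^ 'n::finite \<Rightarrow> real"
  assumes "1 \<le> A"
    and step: "\<And>z i j. z \<in> lattice_box k h y \<Longrightarrow> j \<le> k \<Longrightarrow>
      \<bar>g (axis_upd z i (y $ i + h * real j)) - g z\<bar> \<le> (A - 1) * \<bar>g z\<bar>"
    and "z \<in> lattice_box k h y"
  shows "\<bar>g z - g y\<bar> \<le> (A ^ CARD('n) - 1) * \<bar>g y\<bar>"
proof -
  have "\<forall>z\<in>lattice_box k h y. (\<forall>i. i \<notin> I \<longrightarrow> z $ i = y $ i) \<longrightarrow>
      \<bar>g z - g y\<bar> \<le> (A ^ card I - 1) * \<bar>g y\<bar>" if "finite I" for I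
    using that
  proof (induction I rule: finite_induct)
    case empty
    then show ?case by (auto simp flip: vec_eq_iff)
  next
    case (insert i I)
    show ?case
    proof (intro ballI impI)
      fix z assume z: "z \<in> lattice_box k h y" "\<forall>l. l \<notin> insert i I \<longrightarrow> z $ l = y $ l"
      define z' where "z' = axis_upd z i (y $ i)"
      obtain j where j: "j \<le> k" "z $ i = y $ i + h * real j"
        using z(1) by (auto simp: lattice_box_def)
      \<comment> \<open>The value \<open>y $ i\<close> is the node with \<open>j = 0\<close>, so the
        reset point stays in the box.\<close>
      have z': "z' \<in> lattice_box k h y"
        using z(1) by (auto simp: lattice_box_def z'_def intro: exI[of _ 0])
      have "axis_upd z' i (y $ i + h * real j) = z"
        by (simp add: z'_def vec_eq_iff j(2))
      with step[OF z' j(1), of i] have 1: "\<bar>g z - g z'\<bar> \<le> (A - 1) * \<bar>g z'\<bar>" by simp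
      have 2: "\<bar>g z' - g y\<bar> \<le> (A ^ card I - 1) * \<bar>g y\<bar>"
        using z(2) by (intro insert.IH[rule_format, OF z']) (auto simp: z'_def)
      then have "\<bar>g z'\<bar> \<le> A ^ card I * \<bar>g y\<bar>"
        by (simp add: algebra_simps)
      with \<open>1 \<le> A\<close> have "(A - 1) * \<bar>g z'\<bar> \<le> (A - 1) * (A ^ card I * \<bar>g y\<bar>)"
        by (intro mult_left_mono) auto
      with 1 2 have "\<bar>g z - g y\<bar> \<le> (A - 1) * (A ^ card I * \<bar>g y\<bar>) + (A ^ card I - 1) * \<bar>g y\<bar>"
        by linarith
      also have "\<dots> = (A ^ card (insert i I) - 1) * \<bar>g y\<bar>"
        using insert.hyps by (simp add: algebra_simps)
      finally show "\<bar>g z - g y\<bar> \<le> (A ^ card (insert i I) - 1) * \<bar>g y\<bar>" .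
    qed
  qed
  from this[of UNIV] assms(3) show ?thesis by simp
qed

section \<open>Covering the set where the polynomial is small\<close>

text \<open>The order of quantifiers matters: \<open>c1\<close> and \<open>\<rho>\<close> are fixed
  before \<open>h\<close>, while \<open>C\<close> may grow as \<open>h\<close> shrinks, and none of
  them depends on \<open>g\<close>.\<close>

lemma coord_poly_sublevel_cover:
  fixes R :: real
  assumes "0 \<le> R"
  shows "\<exists>c1>0. \<exists>\<rho>>0. \<forall>h. 0 < h \<longrightarrow> h \<le> 1 \<longrightarrow>
    (\<exists>C>0. \<forall>g :: real ^ 'n::finite \<Rightarrow> real. coord_poly k g \<longrightarrow>
      (\<exists>P. finite P \<and> real (card P) \<le> c1 * (1 / h) ^ (CARD('n) - 1) \<and>
        (\<forall>x. (\<forall>i. \<bar>x $ i\<bar> \<le> R) \<longrightarrow> x \<notin> (\<Union>c\<in>P. cball c (\<rho> * h)) \<longrightarrow>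
          (\<forall>x'. (\<forall>i. \<bar>x' $ i\<bar> \<le> R) \<longrightarrow> \<bar>g x'\<bar> \<le> C * \<bar>g x\<bar>))))"
proof -
  define n where "n = CARD('n)"
  obtain L1 where L1: "L1 \<ge> 1" "\<And>g :: real ^ 'n \<Rightarrow> real. \<And>h e y x. coord_poly k g \<Longrightarrow> h > 0 \<Longrightarrow>
      (\<And>z. z \<in> lattice_box k h y \<Longrightarrow> \<bar>g z\<bar> \<le> e) \<Longrightarrow> (\<And>i. \<bar>x $ i - y $ i\<bar> \<le> 1 * h) \<Longrightarrow> \<bar>g x\<bar> \<le> L1 * e"
    using coord_poly_bound_from_box[of 1 k, where 'n = 'n] by (metis zero_le_one)
  \<comment> \<open>\<open>K\<close> is the required distance from the zeros in units of
    \<open>h\<close>. It is taken so large that the variation of \<open>g\<close> on a box, even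
    after interpolation with constant \<open>L1\<close>, is below half of
    \<open>\<bar>g y\<bar>\<close>.\<close>
  have "((\<lambda>K. (((1 + real k / K) ^ k) ^ n - 1) * L1) \<longlongrightarrow> (((1 + 0) ^ k) ^ n - 1) * L1) at_top"
    by (intro tendsto_intros tendsto_divide_0[OF tendsto_const] filterlim_at_top_imp_at_infinity
        filterlim_ident)
  then have "\<forall>\<^sub>F K in at_top. (((1 + real k / K) ^ k) ^ n - 1) * L1 < 1 / 2"
    by (rule order_tendstoD) simp
  then have "\<forall>\<^sub>F K in at_top. 0 < K \<and> (((1 + real k / K) ^ k) ^ n - 1) * L1 < 1 / 2"
    using eventually_gt_at_top[of "0::real"] by eventually_elim simp
  then obtain K :: real where K: "0 < K" "(((1 + real k / K) ^ k) ^ n - 1) * L1 < 1 / 2"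
    using eventually_happens'[OF trivial_limit_at_top_linorder] by blast
  define A where "A = (1 + real k / K) ^ k"
  have A: "1 \<le> A" "(A ^ n - 1) * L1 < 1 / 2"
    using K by (auto simp: A_def)
  \<comment> \<open>In each coordinate, \<open>K * h\<close> comes from the distance to a zero and
    \<open>(k + 1) * h\<close> from the passage between a box point and \<open>x\<close>; the factor
    \<open>n\<close> comes from bounding the norm by the sum of the coordinates.\<close>
  define \<rho> where "\<rho> = real n * (K + real k + 1)"
  \<comment> \<open>There are \<open>n\<close> directions, \<open>(2 * V + 1) ^ (n - 1)\<close>
    lines in each and at most \<open>k\<close> centres on each line; the base bounds
    \<open>h * (2 * V + 1)\<close>. The final 1 keeps \<open>c1\<close> positive when
    \<open>k = 0\<close>.\<close>
  define c1 where "c1 = real n * real k * (2 * R + 2 * real k + 5) ^ (n - 1) + 1"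
  have "\<rho> > 0" using K(1) by (auto simp: \<rho>_def n_def)
  moreover have "c1 > 0" using assms by (simp add: c1_def add_nonneg_pos)
  moreover have "\<exists>C>0. \<forall>g :: real ^ 'n \<Rightarrow> real. coord_poly k g \<longrightarrow>
      (\<exists>P. finite P \<and> real (card P) \<le> c1 * (1 / h) ^ (n - 1) \<and>
        (\<forall>x. (\<forall>i. \<bar>x $ i\<bar> \<le> R) \<longrightarrow> x \<notin> (\<Union>c\<in>P. cball c (\<rho> * h)) \<longrightarrow>
          (\<forall>x'. (\<forall>i. \<bar>x' $ i\<bar> \<le> R) \<longrightarrow> \<bar>g x'\<bar> \<le> C * \<bar>g x\<bar>)))"
    if h: "0 < h" "h \<le> 1" for h
  proof -
    \<comment> \<open>Rounding \<open>x $ i / h\<close> down gives an integer of absolute value at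
      most \<open>\<lceil>R / h\<rceil> + 1\<close>, and the box extends it by up to
      \<open>k\<close>.\<close>
    define V :: int where "V = \<lceil>R / h\<rceil> + int k + 1"
    \<comment> \<open>\<open>T * h = 2 * R + 1\<close> bounds each coordinate of
      \<open>x' - y\<close>: at most \<open>2 * R\<close> from \<open>x'\<close> to
      \<open>x\<close>, at most \<open>h \<le> 1\<close> from \<open>x\<close> to \<open>y\<close>.
      Through \<open>L2\<close> this makes \<open>C\<close> depend on \<open>h\<close>.\<close>
    define T where "T = (2 * R + 1) / h"
    have "0 \<le> T" using assms h by (simp add: T_def)
    then obtain L2 where L2: "L2 \<ge> 1" "\<And>g :: real ^ 'n \<Rightarrow> real. \<And>h e y x. coord_poly k g \<Longrightarrow> h > 0 \<Longrightarrow>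
        (\<And>z. z \<in> lattice_box k h y \<Longrightarrow> \<bar>g z\<bar> \<le> e) \<Longrightarrow> (\<And>i. \<bar>x $ i - y $ i\<bar> \<le> T * h) \<Longrightarrow> \<bar>g x\<bar> \<le> L2 * e"
      using coord_poly_bound_from_box[of T k, where 'n = 'n] by metis
    define C where "C = L2 * (A ^ n * 2)"
    have "C > 0" using L2(1) A(1) by (simp add: C_def)
    have Vle: "real_of_int (2 * V + 1) \<le> (2 * R + 2 * real k + 5) / h"
    proof -
      have "real_of_int (2 * V + 1) \<le> 2 * (R / h) + (2 * real k + 5)"
        by (simp add: V_def) linarith
      also have "2 * real k + 5 \<le> (2 * real k + 5) / h"
        using h by (simp add: le_divide_eq mult_left_le)
      finally show ?thesis by (simp add: add_divide_distrib algebra_simps)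
    qed
    have "0 \<le> R / h" using assms h by simp
    then have Vpos: "0 \<le> V" unfolding V_def by linarith
    have "\<exists>P. finite P \<and> real (card P) \<le> c1 * (1 / h) ^ (n - 1) \<and>
        (\<forall>x. (\<forall>i. \<bar>x $ i\<bar> \<le> R) \<longrightarrow> x \<notin> (\<Union>c\<in>P. cball c (\<rho> * h)) \<longrightarrow>
          (\<forall>x'. (\<forall>i. \<bar>x' $ i\<bar> \<le> R) \<longrightarrow> \<bar>g x'\<bar> \<le> C * \<bar>g x\<bar>))"
      if g: "coord_poly k g" for g :: "real ^ 'n \<Rightarrow> real"
    proof -
      have "\<exists>Z. finite Z \<and> card Z \<le> k \<and> (\<forall>D>0. \<forall>t t'. (\<forall>z\<in>Z. D \<le> \<bar>t - z\<bar>) \<longrightarrow>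
          \<bar>g (axis_upd x i t') - g (axis_upd x i t)\<bar>
            \<le> ((1 + \<bar>t' - t\<bar> / D) ^ k - 1) * \<bar>g (axis_upd x i t)\<bar>)" for x i
      proof -
        obtain f where "degree f \<le> k" and f: "\<And>t. g (axis_upd x i t) = poly f t"
          using g unfolding coord_poly_def by metis
        from real_poly_oscillation[OF this(1)] show ?thesis unfolding f .
      qed
      then obtain Z where Z: "\<And>x i. finite (Z x i)" "\<And>x i. card (Z x i) \<le> k"
        "\<And>x i D t t'. D > 0 \<Longrightarrow> (\<And>z. z \<in> Z x i \<Longrightarrow> D \<le> \<bar>t - z\<bar>) \<Longrightarrow>
          \<bar>g (axis_upd x i t') - g (axis_upd x i t)\<bar>
            \<le> ((1 + \<bar>t' - t\<bar> / D) ^ k - 1) * \<bar>g (axis_upd x i t)\<bar>"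
        by metis
      \<comment> \<open>\<open>Z x i\<close> was chosen for every \<open>x\<close> separately,
        perhaps differently for two points of the same line. Setting the \<open>i\<close>-th
        coordinate to 0 gives each lattice line one base point, so that finitely many sets
        \<open>Z (base v i) i\<close> suffice.\<close>
      define base :: "('n \<Rightarrow> int) \<Rightarrow> 'n \<Rightarrow> real ^ 'n"
        where "base v i = (\<chi> l. if l = i then 0 else h * real_of_int (v l))" for v i
      define W :: "'n \<Rightarrow> ('n \<Rightarrow> int) set" where "W i = (\<Pi>\<^sub>E l\<in>UNIV - {i}. {-V..V})" for i
      define P where "P = (\<Union>i. \<Union>v\<in>W i. axis_upd (base v i) i ` Z (base v i) i)"
      have finW: "finite (W i)" for i by (auto simp: W_def intro: finite_PiE)
      have cardW: "real (card (W i)) = real_of_int (2 * V + 1) ^ (n - 1)" for i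
        using Vpos by (simp add: W_def card_PiE n_def)
      have finP: "finite P" using finW Z(1) by (auto simp: P_def)
      have "card P \<le> (\<Sum>i\<in>UNIV. card (\<Union>v\<in>W i. axis_upd (base v i) i ` Z (base v i) i))"
        unfolding P_def by (rule card_UN_le) simp
      also have "\<dots> \<le> (\<Sum>i\<in>UNIV. \<Sum>v\<in>W i. card (axis_upd (base v i) i ` Z (base v i) i))"
        by (intro sum_mono card_UN_le finW)
      also have "\<dots> \<le> (\<Sum>i\<in>UNIV. \<Sum>v\<in>W i. k)"
        by (intro sum_mono order_trans[OF card_image_le]) (auto simp: Z)
      finally have "real (card P) \<le> real (\<Sum>i\<in>(UNIV :: 'n set). \<Sum>v\<in>W i. k)"
        by (rule of_nat_mono)
      also have "\<dots> = real n * real k * real_of_int (2 * V + 1) ^ (n - 1)"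
        by (simp add: cardW n_def)
      also have "\<dots> \<le> real n * real k * ((2 * R + 2 * real k + 5) / h) ^ (n - 1)"
        using Vle Vpos by (intro mult_left_mono power_mono) auto
      also have "\<dots> \<le> c1 * (1 / h) ^ (n - 1)"
        using h by (simp add: c1_def power_divide divide_right_mono)
      finally have cardP: "real (card P) \<le> c1 * (1 / h) ^ (n - 1)" .
      have "\<bar>g x'\<bar> \<le> C * \<bar>g x\<bar>"
        if x: "\<forall>i. \<bar>x $ i\<bar> \<le> R" "x \<notin> (\<Union>c\<in>P. cball c (\<rho> * h))" and x': "\<forall>i. \<bar>x' $ i\<bar> \<le> R" for x x'
      proof -
        define v0 where "v0 i = \<lfloor>x $ i / h\<rfloor>" for i
        define y :: "real ^ 'n" where "y = (\<chi> i. h * real_of_int (v0 i))"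
        have xy: "\<bar>x $ i - y $ i\<bar> \<le> h" for i
        proof -
          have "\<bar>x $ i / h - real_of_int (v0 i)\<bar> \<le> 1" unfolding v0_def by linarith
          then have "h * \<bar>x $ i / h - real_of_int (v0 i)\<bar> \<le> h * 1"
            using h by (intro mult_left_mono) auto
          also have "h * \<bar>x $ i / h - real_of_int (v0 i)\<bar> = \<bar>x $ i - y $ i\<bar>"
            using h by (simp add: y_def abs_mult_pos' right_diff_distrib)
          finally show ?thesis by simp
        qed
        have step: "\<bar>g (axis_upd z i (y $ i + h * real j)) - g z\<bar> \<le> (A - 1) * \<bar>g z\<bar>"
          if z: "z \<in> lattice_box k h y" and j: "j \<le> k" for z i j
        proof -
          have "\<forall>l. \<exists>j\<le>k. z $ l = y $ l + h * real j"
            using z by (simp add: lattice_box_def)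
          then obtain m where m: "\<And>l. m l \<le> k" "\<And>l. z $ l = y $ l + h * real (m l)"
            by metis
          define v where "v = restrict (\<lambda>l. v0 l + int (m l)) (UNIV - {i})"
          have inV: "v0 l + int (m l) \<in> {-V..V}" for l
          proof -
            have "\<bar>x $ l / h\<bar> \<le> R / h" using x(1) h by (simp add: divide_right_mono)
            then have "\<bar>real_of_int (v0 l)\<bar> \<le> real_of_int \<lceil>R / h\<rceil> + 1"
              unfolding v0_def by linarith
            then show ?thesis using m(1)[of l] unfolding V_def atLeastAtMost_iff by linarith
          qed
          have "v \<in> W i"
            unfolding W_def v_def restrict_PiE_iff using inV by blast
          have base: "base v i = axis_upd z i 0"
            by (simp add: base_def v_def vec_eq_iff m(2) y_def algebra_simps)
          have zx: "\<bar>z $ l - x $ l\<bar> \<le> (real k + 1) * h" for l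
          proof -
            have "h * real (m l) \<le> h * real k" using m(1) h by simp
            moreover have "0 \<le> h * real (m l)" using h by simp
            moreover have "(real k + 1) * h = h * real k + h" by (simp add: algebra_simps)
            ultimately show ?thesis using xy[of l] unfolding m(2) by linarith
          qed
          \<comment> \<open>A centre coordinate closer than \<open>K * h\<close> would give a point
            \<open>c\<close> of \<open>P\<close>, on the line through \<open>z\<close>, within
            \<open>\<rho> * h\<close> of \<open>x\<close>, contrary to the choice of
            \<open>x\<close>.\<close>
          have far: "K * h \<le> \<bar>z $ i - \<zeta>\<bar>" if \<zeta>: "\<zeta> \<in> Z (base v i) i" for \<zeta>
          proof (rule ccontr)
            assume near: "\<not> K * h \<le> \<bar>z $ i - \<zeta>\<bar>"
            define c where "c = axis_upd (base v i) i \<zeta>"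
            have "\<bar>(c - x) $ l\<bar> \<le> (K + real k + 1) * h" for l
            proof (cases "l = i")
              case True
              then show ?thesis
                using near zx[of i] by (simp add: c_def algebra_simps)
            next
              case False
              have "0 \<le> K * h" using K h by simp
              with False show ?thesis
                using zx[of l] by (simp add: c_def base algebra_simps)
            qed
            then have "norm (c - x) \<le> (\<Sum>l\<in>(UNIV :: 'n set). (K + real k + 1) * h)"
              by (intro order_trans[OF norm_le_l1_cart] sum_mono)
            then have "x \<in> cball c (\<rho> * h)"
              by (simp add: dist_norm \<rho>_def n_def mult.assoc)
            moreover have "c \<in> P"
              using \<open>v \<in> W i\<close> \<zeta> by (auto simp: P_def c_def)
            ultimately show False using x(2) by blast
          qed
          have Kh: "K * h > 0" using K h by simp
          define t' where "t' = y $ i + h * real j"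
          have "\<bar>t' - z $ i\<bar> \<le> real k * h"
          proof -
            have "\<bar>real j - real (m i)\<bar> \<le> real k" using j m(1)[of i] by linarith
            then have "h * \<bar>real j - real (m i)\<bar> \<le> h * real k"
              using h by (intro mult_left_mono) auto
            moreover have "t' - z $ i = h * (real j - real (m i))"
              by (simp add: t'_def m(2) algebra_simps)
            ultimately show ?thesis using h by (simp add: abs_mult mult.commute)
          qed
          then have "\<bar>t' - z $ i\<bar> / (K * h) \<le> real k / K"
            using K h by (simp add: field_simps)
          then have "(1 + \<bar>t' - z $ i\<bar> / (K * h)) ^ k \<le> A"
            unfolding A_def using Kh by (intro power_mono) auto
          then have "((1 + \<bar>t' - z $ i\<bar> / (K * h)) ^ k - 1) * \<bar>g z\<bar> \<le> (A - 1) * \<bar>g z\<bar>"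
            by (intro mult_right_mono) auto
          moreover have "\<bar>g (axis_upd z i t') - g z\<bar> \<le> ((1 + \<bar>t' - z $ i\<bar> / (K * h)) ^ k - 1) * \<bar>g z\<bar>"
            using Z(3)[where t' = t' and x = "base v i" and i = i, OF Kh far] by (simp add: base)
          ultimately show ?thesis by (simp add: t'_def)
        qed
        have osc: "\<bar>g z - g y\<bar> \<le> (A ^ n - 1) * \<bar>g y\<bar>" if "z \<in> lattice_box k h y" for z
          unfolding n_def by (rule lattice_box_oscillation[OF A(1) step that])
        \<comment> \<open>Interpolation is applied to \<open>g - g y\<close>, which is small on the
          whole box. Hence \<open>g x\<close> is close to \<open>g y\<close>, which bounds
          \<open>\<bar>g x\<bar>\<close> from below.\<close>
        have "\<bar>g x - g y\<bar> \<le> L1 * ((A ^ n - 1) * \<bar>g y\<bar>)"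
          using osc xy by (intro L1(2)[OF coord_poly_diff_const[OF g] h(1)]) auto
        also have "\<dots> = ((A ^ n - 1) * L1) * \<bar>g y\<bar>" by simp
        also have "\<dots> \<le> 1 / 2 * \<bar>g y\<bar>"
          using A(2) by (intro mult_right_mono) auto
        finally have gy: "\<bar>g y\<bar> \<le> 2 * \<bar>g x\<bar>" by linarith
        have gz: "\<bar>g z\<bar> \<le> A ^ n * (2 * \<bar>g x\<bar>)" if "z \<in> lattice_box k h y" for z
        proof -
          have "\<bar>g z\<bar> \<le> A ^ n * \<bar>g y\<bar>"
            using osc[OF that] by (simp add: algebra_simps)
          also have "\<dots> \<le> A ^ n * (2 * \<bar>g x\<bar>)"
            using gy A(1) by (intro mult_left_mono) auto
          finally show ?thesis .
        qed
        have "\<bar>x' $ i - y $ i\<bar> \<le> T * h" for i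
        proof -
          have "T * h = 2 * R + 1" using h by (simp add: T_def)
          moreover have "\<bar>x' $ i\<bar> \<le> R" "\<bar>x $ i\<bar> \<le> R" using x x' by auto
          ultimately show ?thesis using xy[of i] h by linarith
        qed
        with gz have "\<bar>g x'\<bar> \<le> L2 * (A ^ n * (2 * \<bar>g x\<bar>))"
          by (intro L2(2)[OF g h(1)])
        then show ?thesis by (simp add: C_def mult.assoc)
      qed
      with finP cardP show ?thesis by blast
    qed
    with \<open>C > 0\<close> show ?thesis by blast
  qed
  ultimately show ?thesis unfolding n_def by blast
qed

subsection \<open>Hausdorff measure\<close>

lemma hausdorff_outer_mono: "E \<subseteq> F \<Longrightarrow> hausdorff_outer s E \<le> hausdorff_outer s F"
  using outer_measure_space_hausdorff_outer[of s]
  by (auto simp: outer_measure_space_def increasing_def)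

lemma hausdorff_outer_empty [simp]: "hausdorff_outer s {} = 0"
  using outer_measure_space_hausdorff_outer[of s]
  by (auto simp: outer_measure_space_def positive_def)

text \<open>\<open>countably_subadditive\<close> speaks of disjoint families only;
  \<open>disjointed\<close> and monotonicity give the general case.\<close>

lemma hausdorff_outer_UN_nat: "hausdorff_outer s (\<Union>i::nat. A i) \<le> suminf (\<lambda>i. hausdorff_outer s (A i))"
proof -
  have "hausdorff_outer s (\<Union>i. A i) = hausdorff_outer s (\<Union>i. disjointed A i)"
    by (simp add: UN_disjointed_eq)
  also have "\<dots> \<le> suminf (\<lambda>i. hausdorff_outer s (disjointed A i))"
    using outer_measure_space_hausdorff_outer[of s] disjoint_family_disjointed[of A]
    by (auto simp: outer_measure_space_def countably_subadditive_def)
  also have "\<dots> \<le> suminf (\<lambda>i. hausdorff_outer s (A i))"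
    by (intro suminf_le hausdorff_outer_mono disjointed_subset) auto
  finally show ?thesis .
qed

lemma hausdorff_outer_Un: "hausdorff_outer s (A \<union> B) \<le> hausdorff_outer s A + hausdorff_outer s B"
proof -
  have "hausdorff_outer s (\<Union>i. binaryset A B i) \<le> suminf (\<lambda>i. hausdorff_outer s (binaryset A B i))"
    by (rule hausdorff_outer_UN_nat)
  then show ?thesis
    by (simp add: UN_binaryset_eq suminf_binaryset_eq[of "hausdorff_outer s"])
qed

lemma hausdorff_outer_UN_finite:
  "finite I \<Longrightarrow> hausdorff_outer s (\<Union>i\<in>I. A i) \<le> (\<Sum>i\<in>I. hausdorff_outer s (A i))"
proof (induction I rule: finite_induct)
  case (insert i I)
  then show ?case
    using hausdorff_outer_Un[of s "A i" "\<Union>i\<in>I. A i"]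
    by (simp add: add_left_mono order_trans)
qed simp

section \<open>Closed sets satisfy Caratheodory's criterion\<close>

lemma hausdorff_pre_antimono:
  assumes "\<delta> \<le> \<delta>'"
  shows "hausdorff_pre s \<delta>' E \<le> hausdorff_pre s \<delta> E"
  unfolding hausdorff_pre_def
  by (rule INF_superset_mono) (use assms in \<open>auto intro: order_trans\<close>)

text \<open>A set of diameter less than \<open>r\<close> cannot meet both \<open>A\<close> and
  \<open>B\<close>, so a fine cover of the union splits into a cover of \<open>A\<close> and one of
  \<open>B\<close>.\<close>

lemma hausdorff_outer_separated:
  fixes A B :: "'a::metric_space set"
  assumes "0 < r" and sep: "\<And>x y. x \<in> A \<Longrightarrow> y \<in> B \<Longrightarrow> r \<le> dist x y"
  shows "hausdorff_outer s A + hausdorff_outer s B \<le> hausdorff_outer s (A \<union> B)"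
proof -
  let ?w = "\<lambda>B :: 'a set. ennreal (unit_ball_vol s * (diameter B / 2) powr s)"
  have pre: "hausdorff_pre s \<delta> A + hausdorff_pre s \<delta> B \<le> hausdorff_pre s \<delta> (A \<union> B)"
    if "0 < \<delta>" "\<delta> < r" for \<delta>
    unfolding hausdorff_pre_def[of s \<delta> "A \<union> B"]
  proof (rule INF_greatest)
    fix F :: "nat \<Rightarrow> 'a set"
    assume "F \<in> {F. A \<union> B \<subseteq> (\<Union>i. F i) \<and> (\<forall>i. bounded (F i) \<and> diameter (F i) \<le> \<delta>)}"
    then have F: "A \<union> B \<subseteq> (\<Union>i. F i)" "\<And>i. bounded (F i)" "\<And>i. diameter (F i) \<le> \<delta>" by auto
    \<comment> \<open>Members missing \<open>E\<close> become empty instead of being dropped, which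
      keeps the index set; the empty set has weight 0.\<close>
    define G where "G E i = (if F i \<inter> E = {} then {} else F i)" for E i
    have pG: "hausdorff_pre s \<delta> E \<le> suminf (\<lambda>i. ?w (G E i))" if "E \<subseteq> A \<union> B" for E
      unfolding hausdorff_pre_def
    proof (rule INF_lower, safe)
      fix x assume "x \<in> E"
      then obtain i where "x \<in> F i" using F(1) \<open>E \<subseteq> A \<union> B\<close> by blast
      with \<open>x \<in> E\<close> show "x \<in> (\<Union>i. G E i)" by (auto simp: G_def)
    next
      fix i
      show "bounded (G E i)" "diameter (G E i) \<le> \<delta>"
        using F \<open>0 < \<delta>\<close> by (auto simp: G_def)
    qed
    have "?w (G A i) + ?w (G B i) \<le> ?w (F i)" for i
    proof -
      have "F i \<inter> A = {} \<or> F i \<inter> B = {}"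
      proof (rule ccontr)
        assume "\<not> ?thesis"
        then obtain x y where "x \<in> F i" "x \<in> A" "y \<in> F i" "y \<in> B" by auto
        then have "r \<le> dist x y" "dist x y \<le> diameter (F i)"
          using sep diameter_bounded_bound[OF F(2)] by auto
        with F(3)[of i] \<open>\<delta> < r\<close> show False by linarith
      qed
      then show ?thesis by (auto simp: G_def)
    qed
    then have "suminf (\<lambda>i. ?w (G A i) + ?w (G B i)) \<le> suminf (\<lambda>i. ?w (F i))"
      by (intro suminf_le) auto
    then have "suminf (\<lambda>i. ?w (G A i)) + suminf (\<lambda>i. ?w (G B i)) \<le> suminf (\<lambda>i. ?w (F i))"
      by (subst suminf_add) auto
    with pG[of A] pG[of B]
    show "hausdorff_pre s \<delta> A + hausdorff_pre s \<delta> B \<le> suminf (\<lambda>i. ?w (F i))"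
      by (meson add_mono order_trans sup_ge1 sup_ge2)
  qed
  show ?thesis
  proof (rule ccontr)
    assume "\<not> ?thesis"
    then have "hausdorff_outer s (A \<union> B) < hausdorff_outer s A + hausdorff_outer s B" by simp
    then have "hausdorff_outer s (A \<union> B) <
        (SUP \<delta>\<in>{0<..}. hausdorff_pre s \<delta> A) + (SUP \<delta>\<in>{0<..}. hausdorff_pre s \<delta> B)"
      by (simp add: hausdorff_outer_def)
    \<comment> \<open>\<open>hausdorff_pre\<close> grows as \<open>\<delta>\<close> shrinks, so both
      suprema can be approached along a common \<open>\<delta>\<close>.\<close>
    also have "\<dots> = (SUP \<delta>\<in>{0<..}. hausdorff_pre s \<delta> A + hausdorff_pre s \<delta> B)"
    proof (rule SUP_add_directed_ennreal[symmetric])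
      fix \<delta>1 \<delta>2 :: real assume "\<delta>1 \<in> {0<..}" "\<delta>2 \<in> {0<..}"
      then show "\<exists>\<delta>\<in>{0<..}. hausdorff_pre s \<delta>1 A + hausdorff_pre s \<delta>2 B
          \<le> hausdorff_pre s \<delta> A + hausdorff_pre s \<delta> B"
        by (intro bexI[of _ "min \<delta>1 \<delta>2"] add_mono hausdorff_pre_antimono) auto
    qed
    finally obtain \<delta> where "0 < \<delta>"
      and lt: "hausdorff_outer s (A \<union> B) < hausdorff_pre s \<delta> A + hausdorff_pre s \<delta> B"
      by (auto simp: less_SUP_iff)
    define \<delta>' where "\<delta>' = min \<delta> (r / 2)"
    have \<delta>': "0 < \<delta>'" "\<delta>' < r" "\<delta>' \<le> \<delta>" using \<open>0 < \<delta>\<close> \<open>0 < r\<close> by (auto simp: \<delta>'_def)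
    have "hausdorff_pre s \<delta> A + hausdorff_pre s \<delta> B \<le> hausdorff_pre s \<delta>' A + hausdorff_pre s \<delta>' B"
      using \<delta>' by (intro add_mono hausdorff_pre_antimono)
    also have "\<dots> \<le> hausdorff_pre s \<delta>' (A \<union> B)" using \<delta>' by (intro pre)
    also have "\<dots> \<le> hausdorff_outer s (A \<union> B)"
      unfolding hausdorff_outer_def using \<delta>' by (intro SUP_upper) auto
    finally show False using lt by simp
  qed
qed

text \<open>Caratheodory's argument for metric outer measures. \<open>D n\<close> is separated from
  \<open>C\<close>, and the rest of \<open>T - C\<close> is covered by the shells \<open>R m\<close>
  with \<open>m \<ge> n\<close>. Shells with indices of the same parity are separated from each
  other, so the measures of all shells are summable and the tail vanishes as \<open>n\<close>
  grows.\<close>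

lemma closed_in_sets_hausdorff_measure:
  fixes C :: "'a::metric_space set"
  assumes "closed C"
  shows "C \<in> sets (hausdorff_measure s)"
proof (cases "C = {}")
  case False
  let ?H = "hausdorff_outer s :: 'a set \<Rightarrow> ennreal"
  have upper: "?H (T \<inter> C) + ?H (T - C) \<le> ?H T" if fin: "?H T < top" for T
  proof -
    define D where "D n = {x \<in> T. 1 / (real n + 1) \<le> infdist x C}" for n :: nat
    define R where "R n = {x \<in> T. 1 / (real n + 2) \<le> infdist x C \<and> infdist x C < 1 / (real n + 1)}"
      for n :: nat
    have sub: "T - C \<subseteq> D n \<union> (\<Union>m. R (m + n))" for n
    proof
      fix x assume x: "x \<in> T - C"
      then have "infdist x C > 0"
        using assms False by (metis DiffD2 in_closed_iff_infdist_zero infdist_nonneg less_eq_real_def)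
      then obtain N0 where N0: "1 / real (Suc N0) < infdist x C" by (rule nat_approx_posE)
      define N where "N = (LEAST N. 1 / (real N + 1) \<le> infdist x C)"
      have N: "1 / (real N + 1) \<le> infdist x C"
        unfolding N_def by (rule LeastI[of _ N0]) (use N0 in \<open>simp add: add.commute\<close>)
      show "x \<in> D n \<union> (\<Union>m. R (m + n))"
      proof (cases "N \<le> n")
        case True
        then have "1 / (real n + 1) \<le> 1 / (real N + 1)" by (simp add: frac_le)
        with N x show ?thesis by (simp add: D_def)
      next
        case False
        define m where "m = N - 1 - n"
        have Nm: "N = Suc (m + n)" using False by (simp add: m_def)
        have "\<not> 1 / (real (m + n) + 1) \<le> infdist x C"
          unfolding N_def by (rule not_less_Least) (simp add: Nm flip: N_def)
        with N x have "x \<in> R (m + n)"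
          by (simp add: R_def Nm add.commute)
        then show ?thesis by blast
      qed
    qed
    have alt: "(\<Sum>i<N. ?H (R (2 * i + b))) \<le> ?H (\<Union>i<N. R (2 * i + b))" for N b
    proof (induction N)
      case (Suc N)
      have "?H (\<Union>i<N. R (2 * i + b)) + ?H (R (2 * N + b))
          \<le> ?H ((\<Union>i<N. R (2 * i + b)) \<union> R (2 * N + b))"
      \<comment> \<open>For \<open>N = 0\<close> the union is empty, and with \<open>b = 0\<close>
        the gap below would involve division by 0. Otherwise \<open>r\<close> is the gap between the
        upper bound \<open>1 / (2 * N + b + 1)\<close> of the new shell and the lower bound
        \<open>1 / (2 * N + b)\<close> of its predecessor.\<close>
      proof (cases "N = 0")
        case False
        define r where "r = 1 / (real (2 * N + b)) - 1 / (real (2 * N + b) + 1)"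
        show ?thesis
        proof (rule hausdorff_outer_separated)
          have "1 / (real (2 * N + b) + 1) < 1 / real (2 * N + b)"
            using False by (intro frac_less2) auto
          then show "0 < r" by (simp add: r_def)
          fix x y assume x: "x \<in> (\<Union>i<N. R (2 * i + b))" and y: "y \<in> R (2 * N + b)"
          from x obtain i where i: "i < N" "x \<in> R (2 * i + b)" by blast
          have "real (2 * i + b) + 2 \<le> real (2 * N + b)" using i(1) by linarith
          then have "1 / real (2 * N + b) \<le> 1 / (real (2 * i + b) + 2)"
            by (intro frac_le) auto
          also have "\<dots> \<le> infdist x C" using i(2) by (simp add: R_def)
          finally have "1 / real (2 * N + b) \<le> infdist x C" .
          moreover have "infdist y C < 1 / (real (2 * N + b) + 1)" using y by (simp add: R_def)
          moreover have "infdist x C \<le> infdist y C + dist x y" by (rule infdist_triangle)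
          ultimately show "r \<le> dist x y" unfolding r_def by linarith
        qed
      qed simp
      also have "(\<Union>i<N. R (2 * i + b)) \<union> R (2 * N + b) = (\<Union>i<Suc N. R (2 * i + b))"
        by (auto simp: lessThan_Suc)
      finally show ?case
        using Suc.IH by (simp add: order_trans[OF add_right_mono])
    qed simp
    have "(\<Sum>i<N. ?H (R i)) \<le> ?H T + ?H T" for N
    proof -
      have "(\<Sum>i<N. ?H (R i)) \<le> (\<Sum>i<2 * N. ?H (R i))"
        by (intro sum_mono2) auto
      also have "\<dots> = (\<Sum>i<N. ?H (R (2 * i + 0))) + (\<Sum>i<N. ?H (R (2 * i + 1)))"
        by (induction N) (auto simp: algebra_simps)
      also have "\<dots> \<le> ?H T + ?H T"
        by (intro add_mono order_trans[OF alt] hausdorff_outer_mono) (auto simp: R_def)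
      finally show ?thesis .
    qed
    then have "suminf (\<lambda>i. ?H (R i)) \<le> ?H T + ?H T"
      by (intro suminf_le_const) auto
    with fin have sumfin: "suminf (\<lambda>i. ?H (R i)) < top"
      by (metis ennreal_add_less_top le_less_trans)
    define g where "g i = enn2real (?H (R i))" for i
    have "?H (R i) \<le> ?H T" for i by (intro hausdorff_outer_mono) (auto simp: R_def)
    then have Hg: "?H (R i) = ennreal (g i)" for i
      unfolding g_def using fin le_less_trans by (subst ennreal_enn2real) blast+
    have "summable g"
      using sumfin unfolding Hg by (intro summable_suminf_not_top) (auto simp: g_def)
    show ?thesis
    proof (rule ennreal_le_epsilon)
      fix e :: real assume "0 < e"
      then obtain n where n: "norm (suminf (\<lambda>i. g (i + n))) < e"
        using suminf_exist_split[OF _ \<open>summable g\<close>] by blast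
      have "summable (\<lambda>m. g (m + n))" using \<open>summable g\<close> by (simp add: summable_iff_shift)
      then have "suminf (\<lambda>m. ?H (R (m + n))) = ennreal (suminf (\<lambda>m. g (m + n)))"
        unfolding Hg by (rule suminf_ennreal2[rotated]) (simp add: g_def)
      also have "\<dots> \<le> ennreal e" using n by (intro ennreal_leI) auto
      finally have tail: "suminf (\<lambda>m. ?H (R (m + n))) \<le> ennreal e" .
      have "?H (T - C) \<le> ?H (D n) + ?H (\<Union>m. R (m + n))"
        by (rule order_trans[OF hausdorff_outer_mono[OF sub] hausdorff_outer_Un])
      also have "\<dots> \<le> ?H (D n) + ennreal e"
        by (intro add_left_mono order_trans[OF hausdorff_outer_UN_nat tail])
      finally have "?H (T \<inter> C) + ?H (T - C) \<le> (?H (T \<inter> C) + ?H (D n)) + ennreal e"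
        by (simp add: add_left_mono add.assoc)
      also have "?H (T \<inter> C) + ?H (D n) \<le> ?H (T \<inter> C \<union> D n)"
      proof (rule hausdorff_outer_separated)
        show "0 < 1 / (real n + 1)" by simp
        fix x y assume "x \<in> T \<inter> C" "y \<in> D n"
        then show "1 / (real n + 1) \<le> dist x y"
          using infdist_le[of x C y] by (auto simp: D_def dist_commute)
      qed
      also have "\<dots> \<le> ?H T" by (intro hausdorff_outer_mono) (auto simp: D_def)
      finally show "?H (T \<inter> C) + ?H (T - C) \<le> ?H T + ennreal e"
        by (simp add: add_right_mono)
    qed
  qed
  have "?H (C \<inter> T) + ?H ((UNIV - C) \<inter> T) = ?H T" for T
  proof (rule antisym)
    show "?H (C \<inter> T) + ?H ((UNIV - C) \<inter> T) \<le> ?H T"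
      using upper[of T] by (cases "?H T = top") (auto simp: less_top Int_commute Diff_eq)
    have "?H T = ?H (C \<inter> T \<union> (UNIV - C) \<inter> T)" by (rule arg_cong[of _ _ ?H]) blast
    also have "\<dots> \<le> ?H (C \<inter> T) + ?H ((UNIV - C) \<inter> T)" by (rule hausdorff_outer_Un)
    finally show "?H T \<le> ?H (C \<inter> T) + ?H ((UNIV - C) \<inter> T)" .
  qed
  then show ?thesis by (simp add: sets_hausdorff_measure lambda_system_def)
qed simp

lemma borel_subset_sets_hausdorff_measure:
  "sets (borel :: 'a::metric_space measure) \<subseteq> sets (hausdorff_measure s)"
proof -
  have "sigma_sets (space (hausdorff_measure s)) (Collect closed) \<subseteq> sets (hausdorff_measure s :: 'a measure)"
    by (rule sets.sigma_sets_subset) (auto simp: closed_in_sets_hausdorff_measure)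
  then show ?thesis by (simp add: borel_eq_closed)
qed

lemma borel_measurable_hausdorff_measure:
  "f \<in> borel_measurable borel \<Longrightarrow> f \<in> borel_measurable (hausdorff_measure s)"
  using borel_subset_sets_hausdorff_measure[of s]
  by (auto simp: measurable_def)

section \<open>Balls with arbitrary centre and radius in upper regular sets\<close>

lemma hausdorff_outer_singleton:
  assumes "0 < s"
  shows "hausdorff_outer s {x :: 'a::metric_space} = 0"
proof -
  have "hausdorff_pre s \<delta> {x} = 0" if "0 < \<delta>" for \<delta>
  proof -
    have "hausdorff_pre s \<delta> {x}
        \<le> suminf (\<lambda>i::nat. ennreal (unit_ball_vol s * (diameter {x} / 2) powr s))"
      unfolding hausdorff_pre_def using that by (intro INF_lower) simp
    then show ?thesis using assms by simp
  qed
  then show ?thesis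
    by (simp add: hausdorff_outer_def SUP_eq_const[of _ _ 0])
qed

text \<open>\<open>upper_regular\<close> controls balls centred in \<open>K\<close> of radius at
  most its diameter, but the exceptional balls may have centres outside \<open>\<omega>\<close>. The
  constant \<open>b\<close> is chosen before \<open>K\<close>.\<close>

lemma hausdorff_outer_regular_cball:
  fixes s a :: real
  assumes "0 < s" "0 < a"
  shows "\<exists>b>0. \<forall>K :: 'a::euclidean_space set. K \<in> upper_regular s a \<longrightarrow> bounded K \<longrightarrow>
    (\<forall>c. \<forall>\<rho>>0. hausdorff_outer s (K \<inter> cball c \<rho>) \<le> ennreal (b * \<rho> powr s))"
proof -
  have "compact (cball (0::'a) 1)" by simp
  then obtain F where F: "finite F" "cball (0::'a) 1 \<subseteq> (\<Union>z\<in>F. ball z (1/4))"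
    unfolding compact_eq_totally_bounded by (metis zero_less_divide_1_iff zero_less_numeral)
  \<comment> \<open>The added 1 ensures \<open>M \<ge> 1\<close>, so that \<open>b\<close> also
    serves the case of a single ball.\<close>
  define M where "M = real (card F) + 1"
  define b where "b = M * a * 3 powr s"
  have "M \<ge> 1" by (simp add: M_def)
  have "hausdorff_outer s (K \<inter> cball c \<rho>) \<le> ennreal (b * \<rho> powr s)"
    if K: "K \<in> upper_regular s a" "bounded K" and \<rho>: "0 < \<rho>" for K :: "'a set" and c \<rho>
  proof -
    define d where "d = diameter K"
    have reg: "hausdorff_outer s (ball x r \<inter> K) \<le> ennreal (a * r powr s)"
      if "x \<in> K" "0 < r" "r \<le> d" for x r
      using K that by (auto simp: upper_regular_def d_def)
    have bnd: "a * (3 * \<rho>) powr s \<le> b * \<rho> powr s" "M * a * (3 * \<rho>) powr s = b * \<rho> powr s"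
      using \<open>M \<ge> 1\<close> \<rho> assms by (auto simp: b_def powr_mult mult_right_mono)
    have dist_d: "dist x y \<le> d" if "x \<in> K" "y \<in> K" for x y
      using diameter_bounded_bound[OF K(2) that] by (simp add: d_def)
    show ?thesis
    proof (cases "K \<inter> cball c \<rho> = {}")
      case False
      then obtain x where x: "x \<in> K" "dist c x \<le> \<rho>" by auto
      consider "3 * \<rho> \<le> d" | "d = 0" | "0 < d" "d < 3 * \<rho>"
        using dist_d[OF x(1) x(1)] by fastforce
      then show ?thesis
      proof cases
        case 1
        have "K \<inter> cball c \<rho> \<subseteq> ball x (3 * \<rho>) \<inter> K"
        proof safe
          fix y assume "y \<in> cball c \<rho>"
          then show "y \<in> ball x (3 * \<rho>)"
            using x dist_triangle[of x y c] \<rho> by (simp add: dist_commute)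
        qed
        then have "hausdorff_outer s (K \<inter> cball c \<rho>) \<le> hausdorff_outer s (ball x (3 * \<rho>) \<inter> K)"
          by (rule hausdorff_outer_mono)
        also have "\<dots> \<le> ennreal (a * (3 * \<rho>) powr s)"
          using x 1 \<rho> by (intro reg) auto
        also have "\<dots> \<le> ennreal (b * \<rho> powr s)"
          using bnd by (simp add: ennreal_leI)
        finally show ?thesis .
      next
        case 2
        then have "K \<inter> cball c \<rho> \<subseteq> {x}"
          using dist_d[OF x(1)] by auto
        then show ?thesis
          using hausdorff_outer_mono[of _ "{x}" s] hausdorff_outer_singleton[OF assms(1), of x]
          by (metis le_zero_eq zero_le)
      next
        case 3
        \<comment> \<open>The open ball of radius \<open>d\<close> about \<open>x\<close> can miss
          points of \<open>K\<close> at distance exactly \<open>d\<close>. So \<open>K\<close> is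
          cut into pieces along a scaled net; each nonempty piece lies in an open ball of radius
          \<open>d\<close> about one of its own points.\<close>
        have cov: "K \<subseteq> (\<Union>z\<in>F. ball (x + d *\<^sub>R z) (d/4) \<inter> K)"
        proof
          fix y assume "y \<in> K"
          then have "(1/d) *\<^sub>R (y - x) \<in> cball 0 1"
            using dist_d[OF x(1), of y] 3 by (simp add: dist_norm norm_minus_commute)
          then obtain z where z: "z \<in> F" "norm (z - (1/d) *\<^sub>R (y - x)) < 1/4"
            using F(2) by (fastforce simp: dist_norm)
          have "x + d *\<^sub>R z - y = d *\<^sub>R (z - (1/d) *\<^sub>R (y - x))"
            using 3 by (simp add: algebra_simps)
          then have "norm (x + d *\<^sub>R z - y) < d/4"
            using z(2) 3 by simp
          then show "y \<in> (\<Union>z\<in>F. ball (x + d *\<^sub>R z) (d/4) \<inter> K)"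
            using z(1) \<open>y \<in> K\<close> by (auto simp: dist_norm)
        qed
        have piece: "hausdorff_outer s (ball z (d/4) \<inter> K) \<le> ennreal (a * d powr s)" for z
        proof (cases "ball z (d/4) \<inter> K = {}")
          case False
          then obtain w where w: "w \<in> K" "dist z w < d/4" by auto
          have "ball z (d/4) \<inter> K \<subseteq> ball w d \<inter> K"
          proof safe
            fix y assume "y \<in> ball z (d/4)"
            then show "y \<in> ball w d"
              using w dist_triangle[of w y z] 3 by (simp add: dist_commute)
          qed
          then have "hausdorff_outer s (ball z (d/4) \<inter> K) \<le> hausdorff_outer s (ball w d \<inter> K)"
            by (rule hausdorff_outer_mono)
          also have "\<dots> \<le> ennreal (a * d powr s)" using w 3 by (intro reg) auto
          finally show ?thesis .
        qed simp
        have "hausdorff_outer s (K \<inter> cball c \<rho>)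
            \<le> hausdorff_outer s (\<Union>z\<in>F. ball (x + d *\<^sub>R z) (d/4) \<inter> K)"
          using cov by (intro hausdorff_outer_mono) blast
        also have "\<dots> \<le> (\<Sum>z\<in>F. hausdorff_outer s (ball (x + d *\<^sub>R z) (d/4) \<inter> K))"
          by (rule hausdorff_outer_UN_finite[OF F(1)])
        also have "\<dots> \<le> (\<Sum>z\<in>F. ennreal (a * d powr s))"
          by (intro sum_mono piece)
        also have "\<dots> = ennreal (real (card F) * (a * d powr s))"
          using assms by (simp add: ennreal_mult ennreal_of_nat_eq_real_of_nat)
        also have "\<dots> \<le> ennreal (M * a * (3 * \<rho>) powr s)"
          using 3 assms by (auto simp: M_def mult.assoc intro!: ennreal_leI mult_mono powr_mono2)
        finally show ?thesis by (simp add: bnd)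
      qed
    qed simp
  qed
  moreover have "b > 0" using \<open>M \<ge> 1\<close> assms by (simp add: b_def)
  ultimately show ?thesis by blast
qed

subsection \<open>Polynomials on upper regular sets\<close>

lemma coord_poly_eval_rpoly:
  fixes p :: "'n::finite rpoly"
  assumes "rpoly_degree p \<le> k"
  shows "coord_poly k (eval_rpoly p)"
  unfolding coord_poly_def
proof (intro allI)
  fix x :: "real ^ 'n" and i
  have deg: "Poly_Mapping.lookup m i \<le> k" if "m \<in> Poly_Mapping.keys p" for m
  proof -
    have "Poly_Mapping.lookup m i \<le> (\<Sum>i\<in>UNIV. Poly_Mapping.lookup m i)"
      by (rule member_le_sum) auto
    also have "\<dots> \<le> rpoly_degree p"
      unfolding rpoly_degree_def using that by (intro Max_ge) auto
    finally show ?thesis using assms by simp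
  qed
  define f where "f = (\<Sum>m\<in>Poly_Mapping.keys p. monom (Poly_Mapping.lookup p m *
    (\<Prod>l\<in>UNIV - {i}. x $ l ^ Poly_Mapping.lookup m l)) (Poly_Mapping.lookup m i))"
  have "degree f \<le> k"
    unfolding f_def by (intro degree_sum_le) (auto intro: order_trans[OF degree_monom_le] deg)
  moreover have "eval_rpoly p (axis_upd x i t) = poly f t" for t
  proof -
    have "(\<Prod>l\<in>UNIV. axis_upd x i t $ l ^ Poly_Mapping.lookup m l)
        = t ^ Poly_Mapping.lookup m i * (\<Prod>l\<in>UNIV - {i}. x $ l ^ Poly_Mapping.lookup m l)" for m
      by (subst prod.remove[of UNIV i]) auto
    then show ?thesis
      by (simp add: eval_rpoly_def f_def poly_sum poly_monom mult_ac)
  qed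
  ultimately show "\<exists>f. degree f \<le> k \<and> (\<forall>t. eval_rpoly p (axis_upd x i t) = poly f t)" by blast
qed

lemma continuous_on_eval_rpoly: "continuous_on S (eval_rpoly p)"
  unfolding eval_rpoly_def by (intro continuous_intros)

lemma borel_measurable_eval_rpoly: "eval_rpoly p \<in> borel_measurable borel"
  by (intro borel_measurable_continuous_onI continuous_on_eval_rpoly)

lemma bdd_above_eval_rpoly:
  assumes "bounded U"
  shows "bdd_above ((\<lambda>x. \<bar>eval_rpoly p x\<bar>) ` U)"
proof -
  have "compact ((\<lambda>x. \<bar>eval_rpoly p x\<bar>) ` closure U)"
    using assms by (intro compact_continuous_image continuous_on_rabs continuous_on_eval_rpoly) auto
  then show ?thesis
    by (meson bdd_above_mono bounded_imp_bdd_above compact_imp_bounded closure_subset image_mono)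
qed

text \<open>With \<open>n = CARD('n)\<close>, the covering balls contribute at most \<open>c1 * (1 /
  h) ^ (n - 1) * b * (\<rho> * h) powr s = B * h powr d\<close>, where \<open>d = s - n + 1\<close>
  is positive. Hence a small \<open>h\<close> works, and \<open>C\<close> is fixed together with
  \<open>h\<close>.\<close>

lemma hausdorff_sublevel_small:
  fixes U :: "(real ^ 'n::finite) set" and s a \<eta> :: real
  assumes "bounded U" "U \<noteq> {}" and s: "real CARD('n) - 1 < s" and "0 < a" "0 < \<eta>"
  shows "\<exists>C>0. \<forall>\<omega> (p :: 'n rpoly). \<omega> \<subseteq> U \<longrightarrow> \<omega> \<in> upper_regular s a \<longrightarrow> rpoly_degree p \<le> k \<longrightarrow>
    hausdorff_outer s {x \<in> \<omega>. C * \<bar>eval_rpoly p x\<bar> < (SUP x\<in>U. \<bar>eval_rpoly p x\<bar>)} \<le> ennreal \<eta>"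
proof -
  define d where "d = s - real (CARD('n) - 1)"
  have d: "d > 0" using s by (simp add: d_def of_nat_diff)
  have "s > 0" using s by (smt (verit) One_nat_def Suc_leI of_nat_1 of_nat_le_iff zero_less_card_finite)
  obtain R0 where "\<forall>x\<in>U. norm x \<le> R0" using assms(1) bounded_iff by metis
  define R where "R = max R0 0"
  have "0 \<le> R" by (simp add: R_def)
  have R: "\<bar>x $ i\<bar> \<le> R" if "x \<in> U" for x i
    using \<open>\<forall>x\<in>U. norm x \<le> R0\<close> that component_le_norm_cart[of x i] unfolding R_def
    by fastforce
  obtain c1 \<rho> where c1: "c1 > 0" and \<rho>: "\<rho> > 0"
    and cover: "\<And>h. 0 < h \<Longrightarrow> h \<le> 1 \<Longrightarrow>
    (\<exists>C>0. \<forall>g :: real ^ 'n \<Rightarrow> real. coord_poly k g \<longrightarrow>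
      (\<exists>P. finite P \<and> real (card P) \<le> c1 * (1 / h) ^ (CARD('n) - 1) \<and>
        (\<forall>x. (\<forall>i. \<bar>x $ i\<bar> \<le> R) \<longrightarrow> x \<notin> (\<Union>c\<in>P. cball c (\<rho> * h)) \<longrightarrow>
          (\<forall>x'. (\<forall>i. \<bar>x' $ i\<bar> \<le> R) \<longrightarrow> \<bar>g x'\<bar> \<le> C * \<bar>g x\<bar>))))"
    using coord_poly_sublevel_cover[OF \<open>0 \<le> R\<close>, of k, where 'n = 'n] by blast
  obtain b where b: "b > 0" and reg: "\<And>K :: (real ^ 'n) set. \<And>c r. K \<in> upper_regular s a \<Longrightarrow> bounded K \<Longrightarrow>
    0 < r \<Longrightarrow> hausdorff_outer s (K \<inter> cball c r) \<le> ennreal (b * r powr s)"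
    using hausdorff_outer_regular_cball[OF \<open>s > 0\<close> \<open>0 < a\<close>, where 'a = "real ^ 'n"] by blast
  define B where "B = c1 * b * \<rho> powr s"
  have "B > 0" using c1 b \<rho> by (simp add: B_def)
  \<comment> \<open>The solution of \<open>B * h powr d = \<eta>\<close>, capped at 1 as the
    covering lemma requires.\<close>
  define h where "h = min 1 ((\<eta> / B) powr (1 / d))"
  have h: "0 < h" "h \<le> 1" using \<open>B > 0\<close> \<open>0 < \<eta>\<close> by (auto simp: h_def)
  have "h powr d \<le> ((\<eta> / B) powr (1 / d)) powr d"
    using d h by (intro powr_mono2) (auto simp: h_def)
  also have "\<dots> = \<eta> / B"
    using d \<open>B > 0\<close> \<open>0 < \<eta>\<close> by (simp add: powr_powr)
  finally have hB: "B * h powr d \<le> \<eta>"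
    using \<open>B > 0\<close> by (simp add: field_simps)
  obtain C where C: "C > 0" and coverC: "\<And>g :: real ^ 'n \<Rightarrow> real. coord_poly k g \<Longrightarrow>
      (\<exists>P. finite P \<and> real (card P) \<le> c1 * (1 / h) ^ (CARD('n) - 1) \<and>
        (\<forall>x. (\<forall>i. \<bar>x $ i\<bar> \<le> R) \<longrightarrow> x \<notin> (\<Union>c\<in>P. cball c (\<rho> * h)) \<longrightarrow>
          (\<forall>x'. (\<forall>i. \<bar>x' $ i\<bar> \<le> R) \<longrightarrow> \<bar>g x'\<bar> \<le> C * \<bar>g x\<bar>)))"
    using cover[OF h] by blast
  have "hausdorff_outer s {x \<in> \<omega>. C * \<bar>eval_rpoly p x\<bar> < (SUP x\<in>U. \<bar>eval_rpoly p x\<bar>)} \<le> ennreal \<eta>"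
    (is "hausdorff_outer s ?E \<le> _")
    if \<omega>: "\<omega> \<subseteq> U" "\<omega> \<in> upper_regular s a" and p: "rpoly_degree p \<le> k" for \<omega> and p :: "'n rpoly"
  proof -
    obtain P where P: "finite P" "real (card P) \<le> c1 * (1 / h) ^ (CARD('n) - 1)"
      "\<And>x x'. (\<forall>i. \<bar>x $ i\<bar> \<le> R) \<Longrightarrow> x \<notin> (\<Union>c\<in>P. cball c (\<rho> * h)) \<Longrightarrow> (\<forall>i. \<bar>x' $ i\<bar> \<le> R) \<Longrightarrow>
        \<bar>eval_rpoly p x'\<bar> \<le> C * \<bar>eval_rpoly p x\<bar>"
      using coverC[OF coord_poly_eval_rpoly[OF p]] by blast
    have "?E \<subseteq> (\<Union>c\<in>P. \<omega> \<inter> cball c (\<rho> * h))"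
    proof
      fix x assume x: "x \<in> ?E"
      have "x \<in> (\<Union>c\<in>P. cball c (\<rho> * h))"
      proof (rule ccontr)
        assume "x \<notin> (\<Union>c\<in>P. cball c (\<rho> * h))"
        then have "(SUP x\<in>U. \<bar>eval_rpoly p x\<bar>) \<le> C * \<bar>eval_rpoly p x\<bar>"
          using x \<omega>(1) R \<open>U \<noteq> {}\<close> by (intro cSUP_least P(3)) auto
        with x show False by simp
      qed
      with x show "x \<in> (\<Union>c\<in>P. \<omega> \<inter> cball c (\<rho> * h))" by blast
    qed
    then have "hausdorff_outer s ?E \<le> hausdorff_outer s (\<Union>c\<in>P. \<omega> \<inter> cball c (\<rho> * h))"
      by (rule hausdorff_outer_mono)
    also have "\<dots> \<le> (\<Sum>c\<in>P. hausdorff_outer s (\<omega> \<inter> cball c (\<rho> * h)))"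
      by (rule hausdorff_outer_UN_finite[OF P(1)])
    also have "\<dots> \<le> (\<Sum>c\<in>P. ennreal (b * (\<rho> * h) powr s))"
      using \<omega> bounded_subset[OF assms(1)] \<rho> h by (intro sum_mono reg) auto
    also have "\<dots> = ennreal (real (card P) * (b * (\<rho> * h) powr s))"
      using b by (simp add: ennreal_mult ennreal_of_nat_eq_real_of_nat)
    also have "\<dots> \<le> ennreal \<eta>"
    proof (rule ennreal_leI)
      have "real (card P) * (b * (\<rho> * h) powr s)
          \<le> c1 * (1 / h) ^ (CARD('n) - 1) * (b * (\<rho> * h) powr s)"
        using P(2) b by (intro mult_right_mono) auto
      also have "\<dots> = B * (h powr s / h ^ (CARD('n) - 1))"
        using h \<rho> by (simp add: B_def powr_mult power_divide)
      also have "\<dots> = B * h powr d"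
        unfolding d_def powr_diff powr_realpow[OF h(1)] ..
      finally show "real (card P) * (b * (\<rho> * h) powr s) \<le> \<eta>" using hB by simp
    qed
    finally show ?thesis .
  qed
  with C show ?thesis by blast
qed

section \<open>Integral means compared with suprema and superlevel sets\<close>

lemma integral_mean_nonneg: "0 \<le> integral_mean M A q f"
  by (simp add: integral_mean_def)

lemma integral_mean_le_bound:
  assumes A: "A \<in> sets M" "0 < measure M A" and f: "f \<in> borel_measurable M"
    and bound: "\<And>x. x \<in> A \<Longrightarrow> \<bar>f x\<bar> \<le> B" and "0 \<le> B" "0 < q"
  shows "integral_mean M A q f \<le> B"
proof (cases "q = \<infinity>")
  case True
  have "esssup (restrict_space M A) (\<lambda>x. ennreal \<bar>f x\<bar>) \<le> ennreal B"
    using f bound by (intro esssup_I measurable_restrict_space1 AE_I2) (auto simp: space_restrict_space intro: ennreal_leI)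
  then have "enn2real (esssup (restrict_space M A) (\<lambda>x. ennreal \<bar>f x\<bar>)) \<le> enn2real (ennreal B)"
    by (intro enn2real_mono) auto
  with True \<open>0 \<le> B\<close> show ?thesis by (simp add: integral_mean_def)
next
  case False
  define Q where "Q = enn2real q"
  have Q: "Q > 0" using \<open>0 < q\<close> False by (simp add: Q_def enn2real_positive_iff less_top)
  \<comment> \<open>\<open>measure\<close> is 0 on sets of infinite measure, so a positive value
    implies finiteness.\<close>
  have fin: "emeasure M A < \<infinity>"
    using A(2) by (metis enn2real_top measure_def less_irrefl top.not_eq_extremum infinity_ennreal_def)
  have "(LINT x:A|M. \<bar>f x\<bar> powr Q) \<le> (LINT x:A|M. B powr Q)"
    unfolding set_lebesgue_integral_def
  proof (rule integral_mono')
    show "integrable M (\<lambda>x. indicat_real A x *\<^sub>R B powr Q)"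
      using A(1) fin by (intro integrable_scaleR_left) auto
  qed (use bound Q in \<open>auto simp: indicator_def intro!: powr_mono2\<close>)
  also have "\<dots> = measure M A * B powr Q"
    using A(1) fin by (simp add: set_lebesgue_integral_def)
  finally have "(LINT x:A|M. \<bar>f x\<bar> powr Q) / measure M A \<le> B powr Q"
    using A(2) by (simp add: divide_le_eq mult.commute)
  moreover have "0 \<le> (LINT x:A|M. \<bar>f x\<bar> powr Q)"
    unfolding set_lebesgue_integral_def by (intro integral_nonneg_AE) auto
  ultimately have "((LINT x:A|M. \<bar>f x\<bar> powr Q) / measure M A) powr (1 / Q) \<le> (B powr Q) powr (1 / Q)"
    using Q by (intro powr_mono2) auto
  also have "\<dots> = B" using Q \<open>0 \<le> B\<close> by (simp add: powr_powr)
  finally show ?thesis using False by (simp add: integral_mean_def Q_def)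
qed

text \<open>Chebyshev's inequality: the level \<open>c\<close> is attained on half of
  \<open>A\<close>, so the mean of the \<open>q\<close>-th power is at least
  \<open>c powr q / 2\<close>. For \<open>q = \<infinity>\<close> the conventions
  \<open>enn2real \<infinity> = 0\<close> and \<open>1 / 0 = 0\<close> turn the factor into 1. The
  bound \<open>B\<close> supplies integrability and a finite essential supremum.\<close>

lemma le_integral_mean_of_large_superlevel:
  assumes A: "A \<in> sets M" "0 < measure M A" and f: "f \<in> borel_measurable M"
    and bound: "\<And>x. x \<in> A \<Longrightarrow> \<bar>f x\<bar> \<le> B" and "0 \<le> c" "0 < q"
    and half: "measure M A \<le> 2 * measure M {x \<in> A. c \<le> \<bar>f x\<bar>}"
  shows "c \<le> 2 powr (1 / enn2real q) * integral_mean M A q f"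
proof -
  define G where "G = {x \<in> A. c \<le> \<bar>f x\<bar>}"
  have "G = A \<inter> {x \<in> space M. c \<le> \<bar>f x\<bar>}"
    using sets.sets_into_space[OF A(1)] by (auto simp: G_def)
  then have G: "G \<in> sets M" using A(1) f by simp
  have fin: "emeasure M A < \<infinity>"
    using A(2) by (metis enn2real_top measure_def less_irrefl top.not_eq_extremum infinity_ennreal_def)
  then have finG: "emeasure M G < \<infinity>"
    using emeasure_mono[OF _ A(1), of G] by (auto simp: G_def intro: le_less_trans)
  have mG: "measure M A \<le> 2 * measure M G" using half by (simp add: G_def)
  show ?thesis
  proof (cases "q = \<infinity>")
    case True
    define N where "N = restrict_space M A"
    define E where "E = esssup N (\<lambda>x. ennreal \<bar>f x\<bar>)"
    have spN: "space N = A"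
      using sets.sets_into_space[OF A(1)] by (auto simp: N_def space_restrict_space)
    have meas: "(\<lambda>x. ennreal \<bar>f x\<bar>) \<in> borel_measurable N"
      unfolding N_def using f by (intro measurable_restrict_space1) auto
    have "E \<le> ennreal B"
      unfolding E_def using bound by (intro esssup_I meas AE_I2) (auto simp: spN intro: ennreal_leI)
    then have "E < top" by (simp add: le_less_trans)
    \<comment> \<open>Otherwise \<open>G\<close> would lie in the null set where
      \<open>\<bar>f x\<bar>\<close> exceeds its essential supremum.\<close>
    have "ennreal c \<le> E"
    proof (rule ccontr)
      assume "\<not> ennreal c \<le> E"
      then have "G \<subseteq> {x \<in> space N. E < ennreal \<bar>f x\<bar>}"
        by (auto simp: G_def spN not_le intro: less_le_trans ennreal_leI)
      moreover have "{x \<in> space N. E < ennreal \<bar>f x\<bar>} \<in> sets N"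
        using meas by simp
      ultimately have "emeasure N G \<le> emeasure N {x \<in> space N. E < ennreal \<bar>f x\<bar>}"
        by (rule emeasure_mono)
      also have "\<dots> = 0" unfolding E_def by (rule esssup_zero_measure)
      finally have "emeasure N G = 0" by simp
      moreover have "emeasure N G = emeasure M G"
        unfolding N_def using A(1) sets.sets_into_space[OF A(1)]
        by (intro emeasure_restrict_space) (auto simp: G_def Int_absorb2)
      ultimately have "measure M G = 0" by (simp add: measure_def)
      with mG A(2) show False by simp
    qed
    then have "enn2real (ennreal c) \<le> enn2real E"
      using \<open>E < top\<close> by (intro enn2real_mono)
    then show ?thesis
      using True \<open>0 \<le> c\<close> by (simp add: integral_mean_def E_def N_def)
  next
    case False
    define Q where "Q = enn2real q"
    have Q: "Q > 0" using \<open>0 < q\<close> False by (simp add: Q_def enn2real_positive_iff less_top)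
    have "measure M G * c powr Q = (LINT x:G|M. c powr Q)"
      using G finG by (simp add: set_lebesgue_integral_def)
    also have "\<dots> \<le> (LINT x:A|M. \<bar>f x\<bar> powr Q)"
      unfolding set_lebesgue_integral_def
    proof (rule integral_mono')
      show "integrable M (\<lambda>x. indicat_real A x *\<^sub>R \<bar>f x\<bar> powr Q)"
      proof (rule Bochner_Integration.integrable_bound)
        show "integrable M (\<lambda>x. indicat_real A x *\<^sub>R B powr Q)"
          using A(1) fin by (intro integrable_scaleR_left) auto
        show "(\<lambda>x. indicat_real A x *\<^sub>R \<bar>f x\<bar> powr Q) \<in> borel_measurable M"
          using f A(1) by measurable
        show "AE x in M. norm (indicat_real A x *\<^sub>R \<bar>f x\<bar> powr Q) \<le> norm (indicat_real A x *\<^sub>R B powr Q)"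
          using bound Q by (auto simp: indicator_def intro!: powr_mono2)
      qed
    qed (use Q \<open>0 \<le> c\<close> in \<open>auto simp: indicator_def G_def intro!: powr_mono2\<close>)
    finally have "c powr Q / 2 \<le> (LINT x:A|M. \<bar>f x\<bar> powr Q) / measure M A"
    proof -
      assume *: "measure M G * c powr Q \<le> (LINT x:A|M. \<bar>f x\<bar> powr Q)"
      have "measure M A * c powr Q \<le> 2 * measure M G * c powr Q"
        using mG by (intro mult_right_mono) auto
      with * A(2) show ?thesis by (simp add: field_simps)
    qed
    then have "(c powr Q / 2) powr (1 / Q) \<le> integral_mean M A q f"
      using False Q by (auto simp: integral_mean_def Q_def[symmetric] intro!: powr_mono2)
    moreover have "(c powr Q / 2) powr (1 / Q) = c / 2 powr (1 / Q)"
      using Q \<open>0 \<le> c\<close> by (simp add: powr_divide powr_powr)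
    ultimately show ?thesis by (simp add: Q_def divide_le_eq mult.commute)
  qed
qed

section \<open>The increasing constant and the conclusion\<close>

text \<open>The infimum of the nonnegative \<open>c\<close> with \<open>V t c\<close> is
  nondecreasing in \<open>t\<close> by \<open>anti\<close>. Adding \<open>1 + t\<close> makes it
  strictly increasing and greater than 1; lying strictly above the infimum, the result still
  satisfies \<open>V t\<close> by \<open>up\<close>.\<close>

lemma ex_strict_mono_constant:
  fixes V :: "real \<Rightarrow> real \<Rightarrow> bool"
  assumes ex: "\<And>t. 0 < t \<Longrightarrow> \<exists>c. V t c"
    and anti: "\<And>t t' c. 0 < t \<Longrightarrow> t \<le> t' \<Longrightarrow> V t' c \<Longrightarrow> V t c"
    and up: "\<And>t c c'. V t c \<Longrightarrow> c \<le> c' \<Longrightarrow> V t c'"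
  shows "\<exists>C. (\<forall>t>0. 1 < C t) \<and> strict_mono_on {0<..} C \<and> (\<forall>t>0. V t (C t))"
proof -
  define X where "X t = {c. 0 \<le> c \<and> V t c}" for t
  define C where "C t = Inf (X t) + 1 + t" for t
  have ne: "X t \<noteq> {}" if "0 < t" for t
  proof -
    obtain c where "V t c" using ex \<open>0 < t\<close> by blast
    then have "max 0 c \<in> X t" using up by (simp add: X_def)
    then show ?thesis by blast
  qed
  have bdd: "bdd_below (X t)" for t by (rule bdd_belowI[of _ 0]) (simp add: X_def)
  have pos: "0 \<le> Inf (X t)" if "0 < t" for t
    using ne[OF that] by (intro cInf_greatest) (auto simp: X_def)
  have Inf_mono: "Inf (X t) \<le> Inf (X t')" if "0 < t" "t \<le> t'" for t t'
    using that anti by (intro cInf_superset_mono ne bdd) (auto simp: X_def)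
  have "C t < C t'" if "0 < t" "t < t'" for t t'
    using Inf_mono[of t t'] that by (simp add: C_def)
  then have "strict_mono_on {0<..} C"
    by (intro strict_mono_onI) auto
  moreover have "1 < C t" if "0 < t" for t using pos[OF that] that by (simp add: C_def)
  moreover have "V t (C t)" if "0 < t" for t
  proof -
    have "Inf (X t) < C t" using that by (simp add: C_def)
    then obtain c where "c \<in> X t" "c < C t" using cInf_lessD[OF ne[OF \<open>0 < t\<close>]] by blast
    then show ?thesis using up by (auto simp: X_def)
  qed
  ultimately show ?thesis by blast
qed

theorem theorem2p6:
  fixes U :: "(real ^ 'n) set" and s a :: real and q r :: ennreal and k :: nat
  assumes "open U" and "bounded U"
    and "real CARD('n) - 1 < s" and "s \<le> real CARD('n)"
    and "0 < a" and "0 < q" and "0 < r"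
  shows "\<exists>C :: real \<Rightarrow> real.
    (\<forall>t>0. 1 < C t) \<and> strict_mono_on {0<..} C \<and>
    (\<forall>\<omega>. \<omega> \<subseteq> U \<longrightarrow> \<omega> \<in> sets (hausdorff_measure s) \<longrightarrow> \<omega> \<in> upper_regular s a \<longrightarrow>
      0 < density_ratio s U \<omega> \<longrightarrow>
      (\<forall>p :: 'n rpoly. rpoly_degree p = k \<longrightarrow>
        integral_mean (hausdorff_measure (real CARD('n))) U r (eval_rpoly p)
          \<le> C (1 / density_ratio s U \<omega>)
              * integral_mean (hausdorff_measure s) \<omega> q (eval_rpoly p)
        \<and> (q = \<infinity> \<and> r = \<infinity> \<longrightarrow>
            (SUP x\<in>U. \<bar>eval_rpoly p x\<bar>)
              \<le> C (1 / density_ratio s U \<omega>) * (SUP x\<in>\<omega>. \<bar>eval_rpoly p x\<bar>))))"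
proof -
  define n where "n = real CARD('n)"
  let ?M = "hausdorff_measure s :: (real ^ 'n) measure"
  let ?Mn = "hausdorff_measure n :: (real ^ 'n) measure"
  define \<mu> where "\<mu> = measure ?Mn U"
  define adm where "adm \<omega> \<longleftrightarrow> \<omega> \<subseteq> U \<and> \<omega> \<in> sets ?M \<and> \<omega> \<in> upper_regular s a \<and> 0 < density_ratio s U \<omega>"
    for \<omega>
  define bnd where "bnd c \<omega> p \<longleftrightarrow>
        integral_mean ?Mn U r (eval_rpoly p) \<le> c * integral_mean ?M \<omega> q (eval_rpoly p)
        \<and> (q = \<infinity> \<and> r = \<infinity> \<longrightarrow>
            (SUP x\<in>U. \<bar>eval_rpoly p x\<bar>) \<le> c * (SUP x\<in>\<omega>. \<bar>eval_rpoly p x\<bar>))"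
    for c \<omega> and p :: "'n rpoly"
  \<comment> \<open>One constant for all \<open>\<omega>\<close> with
    \<open>1 / density_ratio s U \<omega>\<close> at most \<open>t\<close>; the bound
    \<open>t\<close>, unlike an equation, makes \<open>V\<close> antitone in
    \<open>t\<close>.\<close>
  define V where "V t c \<longleftrightarrow> (\<forall>\<omega> p. adm \<omega> \<longrightarrow> 1 / density_ratio s U \<omega> \<le> t \<longrightarrow> rpoly_degree p = k
      \<longrightarrow> bnd c \<omega> p)" for t c
  have "n \<ge> 1" by (simp add: n_def Suc_leI)
  with assms(3) have "s > 0" unfolding n_def by linarith
  have dens: "density_ratio s U \<omega> = measure ?M \<omega> powr (n / s) / \<mu>" for \<omega>
    by (simp add: density_ratio_def n_def \<mu>_def)
  \<comment> \<open>Division by 0 yields 0, so a positive ratio excludes \<open>\<mu> = 0\<close> as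
    well as a vanishing measure of \<open>\<omega>\<close>.\<close>
  have pos: "0 < \<mu>" "0 < measure ?M \<omega>" if "adm \<omega>" for \<omega>
  proof -
    have "0 < measure ?M \<omega> powr (n / s) / \<mu>" using that by (simp add: adm_def dens)
    moreover have "0 \<le> \<mu>" "0 \<le> measure ?M \<omega>" by (auto simp: \<mu>_def)
    ultimately show "0 < \<mu>" "0 < measure ?M \<omega>"
      by (auto simp: zero_less_divide_iff less_le)
  qed
  have ne: "\<omega> \<noteq> {}" if "adm \<omega>" for \<omega>
    using pos(2)[OF that] by auto
  have measp: "eval_rpoly p \<in> borel_measurable (hausdorff_measure s')"
    for p :: "'n rpoly" and s'
    by (intro borel_measurable_hausdorff_measure borel_measurable_eval_rpoly)
  have bddU: "bdd_above ((\<lambda>x. \<bar>eval_rpoly p x\<bar>) ` A)" if "A \<subseteq> U" for A and p :: "'n rpoly"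
    using that bounded_subset[OF assms(2)] by (intro bdd_above_eval_rpoly) auto
  have sup_nonneg: "0 \<le> (SUP x\<in>A. \<bar>eval_rpoly p x\<bar>)" if "A \<subseteq> U" "A \<noteq> {}" for A and p :: "'n rpoly"
  proof -
    obtain x where "x \<in> A" using \<open>A \<noteq> {}\<close> by blast
    then show ?thesis by (rule cSUP_upper2[OF bddU[OF \<open>A \<subseteq> U\<close>]]) simp
  qed
  have ex: "\<exists>c. V t c" if "0 < t" for t
  proof (cases "\<mu> > 0")
    case False
    \<comment> \<open>No \<open>\<omega>\<close> is admissible here, so any constant will
      do.\<close>
    then have "V t 1" using pos(1) by (auto simp: V_def)
    then show ?thesis ..
  next
    case True
    \<comment> \<open>Solving \<open>1 / density_ratio s U \<omega> \<le> t\<close> for the measure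
      of \<open>\<omega>\<close> gives the lower bound \<open>m\<close>, the same for all such
      \<open>\<omega>\<close>.\<close>
    define m where "m = (\<mu> / t) powr (s / n)"
    have "m > 0" using True that by (simp add: m_def)
    have "U \<noteq> {}" using True by (auto simp: \<mu>_def)
    obtain C where "C > 0" and C: "\<And>\<omega> (p :: 'n rpoly). \<omega> \<subseteq> U \<Longrightarrow> \<omega> \<in> upper_regular s a \<Longrightarrow> rpoly_degree p \<le> k \<Longrightarrow>
        hausdorff_outer s {x \<in> \<omega>. C * \<bar>eval_rpoly p x\<bar> < (SUP x\<in>U. \<bar>eval_rpoly p x\<bar>)} \<le> ennreal (m / 2)"
      using hausdorff_sublevel_small[OF assms(2) \<open>U \<noteq> {}\<close> assms(3,5), of "m / 2" k] \<open>m > 0\<close> by auto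
    have "bnd (C * 2 powr (1 / enn2real q)) \<omega> p"
      if adm: "adm \<omega>" and t: "1 / density_ratio s U \<omega> \<le> t" and p: "rpoly_degree p = k" for \<omega> p
    proof -
      define S where "S = (SUP x\<in>U. \<bar>eval_rpoly p x\<bar>)"
      have S: "\<bar>eval_rpoly p x\<bar> \<le> S" if "x \<in> U" for x
        unfolding S_def using that bddU by (intro cSUP_upper) auto
      have "0 \<le> S" unfolding S_def using \<open>U \<noteq> {}\<close> by (intro sup_nonneg) auto
      have \<omega>: "\<omega> \<subseteq> U" "\<omega> \<in> sets ?M" "\<omega> \<in> upper_regular s a" using adm by (auto simp: adm_def)
      have "\<mu> / t \<le> measure ?M \<omega> powr (n / s)"
        using t pos[OF adm] \<open>0 < t\<close> by (simp add: dens field_simps)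
      then have "m \<le> (measure ?M \<omega> powr (n / s)) powr (s / n)"
        unfolding m_def using True \<open>0 < t\<close> \<open>s > 0\<close> \<open>n \<ge> 1\<close> by (intro powr_mono2) auto
      also have "\<dots> = measure ?M \<omega>"
        using pos[OF adm] \<open>s > 0\<close> \<open>n \<ge> 1\<close> by (simp add: powr_powr)
      finally have m: "m \<le> measure ?M \<omega>" .
      \<comment> \<open>The exceptional part \<open>L\<close> has measure at most
        \<open>m / 2\<close>, hence \<open>G\<close> carries at least half of
        \<open>\<omega>\<close>.\<close>
      define G where "G = {x \<in> \<omega>. S / C \<le> \<bar>eval_rpoly p x\<bar>}"
      define L where "L = {x \<in> \<omega>. C * \<bar>eval_rpoly p x\<bar> < S}"
      have LG: "L = \<omega> - G" using \<open>C > 0\<close> by (auto simp: L_def G_def field_simps not_le)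
      have "G = \<omega> \<inter> {x \<in> space ?M. S / C \<le> \<bar>eval_rpoly p x\<bar>}" by (auto simp: G_def)
      then have Gm: "G \<in> sets ?M" using \<omega>(2) measp by simp
      then have Lm: "L \<in> sets ?M" using \<omega>(2) by (simp add: LG)
      have finL: "emeasure ?M L \<le> ennreal (m / 2)"
        using C[OF \<omega>(1,3), of p] p Lm by (simp add: emeasure_hausdorff_measure L_def S_def)
      then have "measure ?M L \<le> m / 2"
        unfolding measure_def using \<open>m > 0\<close> by (intro enn2real_leI) auto
      moreover have "measure ?M \<omega> \<le> measure ?M L + measure ?M G"
      proof -
        have "\<omega> = L \<union> G" by (auto simp: LG G_def)
        then show ?thesis using measure_Un_le[OF Lm Gm] by simp
      qed
      ultimately have half: "measure ?M \<omega> \<le> 2 * measure ?M G" using m by linarith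
      have "S / C \<le> 2 powr (1 / enn2real q) * integral_mean ?M \<omega> q (eval_rpoly p)"
        using \<omega> pos[OF adm] measp S \<open>0 \<le> S\<close> \<open>C > 0\<close> half assms(6)
        by (intro le_integral_mean_of_large_superlevel) (auto simp: G_def)
      then have "S \<le> C * 2 powr (1 / enn2real q) * integral_mean ?M \<omega> q (eval_rpoly p)"
        using \<open>C > 0\<close> by (simp add: field_simps)
      moreover have "integral_mean ?Mn U r (eval_rpoly p) \<le> S"
        using pos(1)[OF adm] measp S \<open>0 \<le> S\<close> assms(1,7) borel_subset_sets_hausdorff_measure[of n]
        by (intro integral_mean_le_bound) (auto simp: \<mu>_def)
      \<comment> \<open>\<open>integral_mean\<close> with exponent \<open>\<infinity>\<close> is an
        essential supremum; for the true supremum over \<open>\<omega>\<close> a single point of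
        \<open>G\<close> suffices. The power of 2 equals 1 here.\<close>
      moreover have "S \<le> C * 2 powr (1 / enn2real q) * (SUP x\<in>\<omega>. \<bar>eval_rpoly p x\<bar>)" if "q = \<infinity>"
      proof -
        have "measure ?M G > 0" using half pos(2)[OF adm] by simp
        then have "G \<noteq> {}" by auto
        then obtain x where x: "x \<in> \<omega>" "S / C \<le> \<bar>eval_rpoly p x\<bar>" by (auto simp: G_def)
        then have "S / C \<le> (SUP x\<in>\<omega>. \<bar>eval_rpoly p x\<bar>)"
          using bddU[OF \<omega>(1)] by (intro cSUP_upper2)
        then show ?thesis using \<open>C > 0\<close> that by (simp add: field_simps)
      qed
      ultimately show ?thesis by (auto simp: bnd_def S_def)
    qed
    then show ?thesis by (auto simp: V_def)
  qed
  have up: "V t c'" if "V t c" "c \<le> c'" for t c c'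
    unfolding V_def
  proof (intro allI impI)
    fix \<omega> and p :: "'n rpoly"
    assume \<omega>: "adm \<omega>" "1 / density_ratio s U \<omega> \<le> t" "rpoly_degree p = k"
    then have "bnd c \<omega> p" using \<open>V t c\<close> by (simp add: V_def)
    moreover have "c * integral_mean ?M \<omega> q (eval_rpoly p) \<le> c' * integral_mean ?M \<omega> q (eval_rpoly p)"
      using \<open>c \<le> c'\<close> by (intro mult_right_mono integral_mean_nonneg)
    \<comment> \<open>The sign of this supremum is known because \<open>\<omega>\<close> is
      nonempty; over the empty set it would be an unspecified real.\<close>
    moreover have "c * (SUP x\<in>\<omega>. \<bar>eval_rpoly p x\<bar>) \<le> c' * (SUP x\<in>\<omega>. \<bar>eval_rpoly p x\<bar>)"
      using \<open>c \<le> c'\<close> \<omega>(1) ne by (intro mult_right_mono sup_nonneg) (auto simp: adm_def)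
    ultimately show "bnd c' \<omega> p" unfolding bnd_def by (meson order_trans)
  qed
  have anti: "V t c" if "0 < t" "t \<le> t'" "V t' c" for t t' c
    unfolding V_def
  proof (intro allI impI)
    fix \<omega> and p :: "'n rpoly"
    assume "adm \<omega>" "1 / density_ratio s U \<omega> \<le> t" "rpoly_degree p = k"
    moreover from this \<open>t \<le> t'\<close> have "1 / density_ratio s U \<omega> \<le> t'" by linarith
    ultimately show "bnd c \<omega> p" using \<open>V t' c\<close> by (simp add: V_def)
  qed
  have "\<exists>C. (\<forall>t>0. 1 < C t) \<and> strict_mono_on {0<..} C \<and> (\<forall>t>0. V t (C t))"
    by (rule ex_strict_mono_constant) (fact ex, fact anti, fact up)
  then obtain C where C: "\<forall>t>0. 1 < C t" "strict_mono_on {0<..} C" "\<forall>t>0. V t (C t)"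
    by blast
  have "bnd (C (1 / density_ratio s U \<omega>)) \<omega> p" if "adm \<omega>" "rpoly_degree p = k" for \<omega> p
  proof -
    have "1 / density_ratio s U \<omega> > 0" using that by (simp add: adm_def)
    with C(3) that show ?thesis unfolding V_def by blast
  qed
  with C(1,2) show ?thesis
    unfolding adm_def bnd_def n_def by (intro exI[of _ C]) blast
qed

end
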